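(* Let $N\ge 1$ and let $\rho\in\{231,132,213\}$. For each $1\le k\le N$, the number of $\rho$-avoiding permutations in $\mathfrak{S}_N$ with exactly $k$ left-to-right maxima is the Catalan ballot triangle entry $\frac{k}{2N-k}\binom{2N-k}{N}$ (in particular, it is the same for all three patterns). The expected number of left-to-right maxima of a uniformly random $\rho$-avoiding permutation in $\mathfrak{S}_N$ is $$\frac{C_{N+1}}{C_N}-1=\frac{3N}{N+2},$$ and the win probability of the strategy-indifferent game of best choice of rank $N+1$ whose bine of competitors is the set of $\rho$-avoiding permutations in $\mathfrak{S}_N$ tends to $1/4$ as $N\to\infty$.
   Context: $\mathfrak{S}_n$ is the set of permutations of $\{1,\dots,n\}$ in one-line notation; $C_n=\frac{1}{n+1}\binom{2n}{n}$ is the $n$th Catalan number. A permutation avoids a pattern $\rho\in\mathfrak{S}_3$ if it has no (not necessarily consecutive) subsequence of length 3 with the same relative order as $\rho$. An entry $\pi_j$ is a left-to-right maximum if $\pi_i<\pi_j$ for all $i<j$; then $j$ is a left-to-right maximum position. The flattening of a sequence of $i$ distinct integers is the unique permutation of $\{1,\dots,i\}$ with the same relative order; $\pi|_{[i]}$ denotes the flattening of $\pi_1,\dots,\pi_i$. Game of best choice of rank $n$ defined by a nonempty finite multiset $\mathcal{I}$ of elements of $\mathfrak{S}_n$: $\pi\in\mathcal{I}$ is chosen uniformly at random (with multiplicity) and $\pi|_{[1]},\pi|_{[2]},\dots$ are presented sequentially. A strategy is given by a strike set $A$ of prefixes: the player stops at the first $i$ with $\pi|_{[i]}\in A$, and wins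 if and only if such $i$ exists and $\pi_i=n$. The prefix tree $\mathcal{P}_n$ is the set of permutations in $\bigcup_{i=1}^n\mathfrak{S}_i$ whose last entry is a left-to-right maximum, ordered by: $q$ contains $p$ if $q|_{[i]}=p$, where $i$ is the size of $p$. A maximal antichain of $\mathcal{P}_n$ is a set of pairwise incomparable elements such that every element of $\mathcal{P}_n$ is comparable to some element of it. The game is strategy-indifferent if all strike sets that are maximal antichains of $\mathcal{P}_n$ have the same probability of winning, called the win probability. For a finite nonempty multiset $\mathcal{J}'$ of elements of $\mathfrak{S}_{n-1}$, a strategy-indifferent game of rank $n$ with bine of competitors $\mathcal{J}'$ is a multiset $\mathcal{I}$ constructed as follows: let $\mathcal{J}$ be obtained by appending $n$ to each element of $\mathcal{J}'$; for each $\pi\in\mathcal{J}$ and each left-to-right maximum position $i$ of $\pi$, include in $\mathcal{I}$ one permutation $\widetilde\pi\in\mathfrak{S}_n$ with $\widetilde\pi|_{[i]}=\pi|_{[i]}$ and $\widetilde\pi_i=n$ (arbitrary choice; the win probability does not depend on the choices). *)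

theory Defs
  imports
    "HOL-Probability.Probability"
    "HOL-Combinatorics.Multiset_Permutations"
    "HOL-Library.Sublist"
begin

text \<open>
  Permutations in one-line notation are lists. Positions are numbered from 1 throughout, so the
  entry \<open>\<pi>\<^sub>j\<close> is \<open>\<pi> ! (j - 1)\<close>.
\<close>

definition perms :: "nat \<Rightarrow> nat list set" where
  "perms n = permutations_of_set {1..n}"

text \<open>Meaningful for lists of distinct entries: each entry is replaced by its rank.\<close>

definition flatten :: "nat list \<Rightarrow> nat list" where
  "flatten xs = map (\<lambda>x. card {y \<in> set xs. y \<le> x}) xs"

definition flat_prefix :: "nat \<Rightarrow> nat list \<Rightarrow> nat list" where
  "flat_prefix i \<pi> = flatten (take i \<pi>)"

definition avoids :: "nat list \<Rightarrow> nat list \<Rightarrow> bool" where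
  "avoids \<pi> \<rho> \<longleftrightarrow> \<not> (\<exists>xs. subseq xs \<pi> \<and> flatten xs = \<rho>)"

definition avoiders :: "nat list \<Rightarrow> nat \<Rightarrow> nat list set" where
  "avoiders \<rho> n = {\<pi> \<in> perms n. avoids \<pi> \<rho>}"

definition ltr_max_positions :: "nat list \<Rightarrow> nat set" where
  "ltr_max_positions \<pi> =
     {j \<in> {1..length \<pi>}. \<forall>i \<in> {1..<j}. \<pi> ! (i - 1) < \<pi> ! (j - 1)}"

definition num_ltr_max :: "nat list \<Rightarrow> nat" where
  "num_ltr_max \<pi> = card (ltr_max_positions \<pi>)"

definition catalan :: "nat \<Rightarrow> real" where
  "catalan n = 1 / (real n + 1) * real ((2 * n) choose n)"


definition wins :: "nat \<Rightarrow> nat list set \<Rightarrow> nat list \<Rightarrow> bool" where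
  "wins n A \<pi> \<longleftrightarrow>
     (\<exists>i \<in> {1..n}. flat_prefix i \<pi> \<in> A \<and> (\<forall>j \<in> {1..<i}. flat_prefix j \<pi> \<notin> A) \<and>
        \<pi> ! (i - 1) = n)"

definition strike_win_prob :: "nat \<Rightarrow> nat list multiset \<Rightarrow> nat list set \<Rightarrow> real" where
  "strike_win_prob n I A = measure_pmf.prob (pmf_of_multiset I) {\<pi>. wins n A \<pi>}"

definition prefix_tree :: "nat \<Rightarrow> nat list set" where
  "prefix_tree n = {p. \<exists>i \<in> {1..n}. p \<in> perms i \<and> i \<in> ltr_max_positions p}"

definition contains_prefix :: "nat list \<Rightarrow> nat list \<Rightarrow> bool" where
  "contains_prefix q p \<longleftrightarrow> length p \<le> length q \<and> flat_prefix (length p) q = p"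

definition comparable :: "nat list \<Rightarrow> nat list \<Rightarrow> bool" where
  "comparable p q \<longleftrightarrow> contains_prefix p q \<or> contains_prefix q p"

definition maximal_antichain :: "nat \<Rightarrow> nat list set \<Rightarrow> bool" where
  "maximal_antichain n A \<longleftrightarrow>
     A \<subseteq> prefix_tree n \<and>
     (\<forall>p \<in> A. \<forall>q \<in> A. p \<noteq> q \<longrightarrow> \<not> comparable p q) \<and>
     (\<forall>p \<in> prefix_tree n. \<exists>q \<in> A. comparable p q)"

definition strategy_indifferent :: "nat \<Rightarrow> nat list multiset \<Rightarrow> bool" where
  "strategy_indifferent n I \<longleftrightarrow>
     (\<forall>A B. maximal_antichain n A \<longrightarrow> maximal_antichain n B \<longrightarrow>
        strike_win_prob n I A = strike_win_prob n I B)"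

text \<open>Well defined for strategy-indifferent games.\<close>

definition win_probability :: "nat \<Rightarrow> nat list multiset \<Rightarrow> real" where
  "win_probability n I = (THE p. \<forall>A. maximal_antichain n A \<longrightarrow> strike_win_prob n I A = p)"

text \<open>
  \<open>bine_game n J' I\<close>: the multiset \<open>I\<close> is one of the possible results of the construction of a
  strategy-indifferent game of rank \<open>n\<close> from the bine of competitors \<open>J'\<close>. The pairs of a competitor
  (counted with multiplicity, with \<open>n\<close> appended) and one of its left-to-right maximum positions are
  matched one-to-one with the elements of \<open>I\<close>; the choice for each pair is independent,
  even between repeated copies of the same competitor.
\<close>

definition competitor_positions :: "nat \<Rightarrow> nat list multiset \<Rightarrow> (nat list \<times> nat) multiset" where
  "competitor_positions n J' =
     (\<Sum>\<pi> \<in># image_mset (\<lambda>\<sigma>. \<sigma> @ [n]) J'. image_mset (Pair \<pi>) (mset_set (ltr_max_positions \<pi>)))"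

definition bine_game :: "nat \<Rightarrow> nat list multiset \<Rightarrow> nat list multiset \<Rightarrow> bool" where
  "bine_game n J' I \<longleftrightarrow>
     n \<ge> 1 \<and> J' \<noteq> {#} \<and> set_mset J' \<subseteq> perms (n - 1) \<and>
     rel_mset
       (\<lambda>(\<pi>, i) \<tau>. \<tau> \<in> perms n \<and> flat_prefix i \<tau> = flat_prefix i \<pi> \<and> \<tau> ! (i - 1) = n)
       (competitor_positions n J') I"

end

(*
  For each of the three patterns the avoiders of size N+1 with k+1 left-to-right maxima are in
  bijection with the avoiders of size N with at least k left-to-right maxima. For 231 and 213 the
  bijection deletes the largest entry; for 132 it deletes the first entry, which must be the one
  with exactly k larger entries. The resulting recursion has the solution
  binom(2N-k-1, N-1) - binom(2N-k-1, N), the ballot numbers. Summing the recursion over k gives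
  sum (ltr + 1) = C_{N+1}, hence the expectation.

  In a game built from a bine, each competitor has exactly one prefix in a given maximal antichain,
  so exactly one of the permutations made from it is won, whatever the strike set. The win
  probability is therefore |J'| / sum (ltr + 1) = C_N / C_{N+1}.
*)

theory Submission
  imports
    Defs
    "HOL-Real_Asymp.Real_Asymp"
begin

section \<open>Left-to-right maxima\<close>

text \<open>Putting the largest entry \<open>n\<close> between \<open>L\<close> and \<open>R\<close>
  gives \<open>num_ltr_max L + 1\<close> left-to-right maxima. Deleting \<open>n\<close> is
  therefore a bijection once, for each k up to \<open>num_ltr_max (L @ R)\<close>, exactly one cut
  that creates no occurrence has \<open>num_ltr_max L = k\<close>. This is true for 231 and 213 but
  fails for 132: there a nonempty \<open>L\<close> must lie entirely above \<open>R\<close>, so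
  \<open>L\<close> already holds every maximum and only 0 and the full number occur. For 132 an
  entry \<open>v\<close> is put in front instead. The entries above \<open>v\<close> must then
  increase, so together with \<open>v\<close> they are exactly the maxima, and prescribing their
  number k prescribes \<open>v\<close>. What has to be shown is that "they increase" is the same
  condition as "k is at most the number of maxima of the rest". The summand ltr + 1 arises twice: an
  avoider with m maxima is counted once for each k in 0..m when the recursion is summed, and a
  competitor has one maximum more once the largest entry is appended. This is why the size of the
  game is again a Catalan number.\<close>

lemma perms_iff: "xs \<in> perms n \<longleftrightarrow> set xs = {1..n} \<and> distinct xs"
  by (auto simp: perms_def permutations_of_set_def)

lemma perms_length: "xs \<in> perms n \<Longrightarrow> length xs = n"
  using distinct_card[of xs] by (auto simp: perms_iff)

lemma finite_avoiders: "finite (avoiders \<rho> n)"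
  by (simp add: avoiders_def perms_def)

text \<open>An appended entry cannot change the status of earlier positions; the list inductions on
  this statistic therefore run by \<open>rev_induct\<close>.\<close>

lemma ltr_max_positions_snoc:
  "ltr_max_positions (xs @ [x]) =
     ltr_max_positions xs \<union> (if \<forall>y\<in>set xs. y < x then {Suc (length xs)} else {})"
proof -
  have all: "(\<forall>y\<in>set xs. y < x) \<longleftrightarrow> (\<forall>i\<in>{1..length xs}. xs ! (i - 1) < x)"
  proof
    assume *: "\<forall>i\<in>{1..length xs}. xs ! (i - 1) < x"
    show "\<forall>y\<in>set xs. y < x"
    proof
      fix y assume "y \<in> set xs"
      then obtain i where "i < length xs" "y = xs ! i" by (auto simp: in_set_conv_nth)
      with *[rule_format, of "Suc i"] show "y < x" by simp
    qed
  qed auto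
  have "j \<in> ltr_max_positions (xs @ [x]) \<longleftrightarrow>
    j \<in> ltr_max_positions xs \<union> (if \<forall>y\<in>set xs. y < x then {Suc (length xs)} else {})" for j
  proof (cases "j = Suc (length xs)")
    case True
    have "{1..<Suc (length xs)} = {1..length xs}" by auto
    with True all show ?thesis
      by (auto simp: ltr_max_positions_def nth_append)
  next
    case False
    have "\<And>i. i < j \<Longrightarrow> j \<le> length xs \<Longrightarrow> i - 1 < length xs" by auto
    with False show ?thesis
      by (auto simp: ltr_max_positions_def nth_append)
  qed
  then show ?thesis by blast
qed

lemma finite_ltr_max_positions [simp]: "finite (ltr_max_positions xs)"
  by (simp add: ltr_max_positions_def)

lemma num_ltr_max_Nil [simp]: "num_ltr_max [] = 0"
  by (simp add: num_ltr_max_def ltr_max_positions_def)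

lemma num_ltr_max_snoc:
  "num_ltr_max (xs @ [x]) = num_ltr_max xs + (if \<forall>y\<in>set xs. y < x then 1 else 0)"
proof -
  have "Suc (length xs) \<notin> ltr_max_positions xs" by (auto simp: ltr_max_positions_def)
  then show ?thesis by (simp add: num_ltr_max_def ltr_max_positions_snoc)
qed

lemma num_ltr_max_mono: "num_ltr_max xs \<le> num_ltr_max (xs @ ys)"
  by (induction ys rule: rev_induct) (auto simp: num_ltr_max_snoc simp flip: append_assoc)

lemma num_ltr_max_le_length: "num_ltr_max xs \<le> length xs"
  by (induction xs rule: rev_induct) (auto simp: num_ltr_max_snoc)

lemma num_ltr_max_pos: "xs \<noteq> [] \<Longrightarrow> num_ltr_max xs > 0"
  using num_ltr_max_mono[of "[hd xs]" "tl xs"] num_ltr_max_snoc[of "[]" "hd xs"] by simp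

lemma num_ltr_max_sorted: "sorted_wrt (<) xs \<Longrightarrow> num_ltr_max xs = length xs"
  by (induction xs rule: rev_induct) (auto simp: num_ltr_max_snoc sorted_wrt_append)

text \<open>\<open>n\<close> is a maximum itself and hides everything in \<open>R\<close>, while
  \<open>L\<close> keeps its maxima.\<close>

lemma num_ltr_max_insert_max:
  assumes "\<And>y. y \<in> set L \<union> set R \<Longrightarrow> y < n"
  shows "num_ltr_max (L @ n # R) = Suc (num_ltr_max L)"
  using assms
proof (induction R rule: rev_induct)
  case Nil
  then show ?case by (simp add: num_ltr_max_snoc)
next
  case (snoc x R)
  have "num_ltr_max ((L @ n # R) @ [x]) = Suc (num_ltr_max L)"
    unfolding num_ltr_max_snoc using snoc by (auto simp: not_less_iff_gr_or_eq)
  then show ?case by simp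
qed

text \<open>The cut is just before the (k+1)-st left-to-right maximum \<open>hd R\<close>, or at the
  end if there is none. This is where the largest entry is reinserted for 231.\<close>

lemma longest_prefix:
  assumes "k \<le> num_ltr_max xs"
  shows "\<exists>L R. xs = L @ R \<and> num_ltr_max L = k \<and>
    (R = [] \<or> (\<forall>y\<in>set L. y < hd R))"
  using assms
proof (induction xs rule: rev_induct)
  case Nil
  then show ?case by auto
next
  case (snoc x xs)
  show ?case
  proof (cases "k \<le> num_ltr_max xs")
    case True
    then obtain L R where LR: "xs = L @ R" "num_ltr_max L = k" "R = [] \<or> (\<forall>y\<in>set L. y < hd R)"
      using snoc by blast
    show ?thesis
    proof (cases "R = []")
      case True
      show ?thesis
      proof (cases "\<forall>y\<in>set xs. y < x")
        case t: True
        then show ?thesis using LR True by (intro exI[of _ xs] exI[of _ "[x]"]) auto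
      next
        case False
        then show ?thesis using LR True
          by (intro exI[of _ "xs @ [x]"] exI[of _ "[]"]) (auto simp: num_ltr_max_snoc)
      qed
    next
      case False
      then show ?thesis using LR by (intro exI[of _ L] exI[of _ "R @ [x]"]) auto
    qed
  next
    case False
    then have "num_ltr_max (xs @ [x]) = k"
      using snoc.prems by (auto simp: num_ltr_max_snoc split: if_splits)
    then show ?thesis by (intro exI[of _ "xs @ [x]"] exI[of _ "[]"]) auto
  qed
qed

text \<open>Here \<open>x\<close> is the (k+1)-st left-to-right maximum, so \<open>L @ [x]\<close>
  is the shortest prefix with k+1 of them. This is the cut needed for 213.\<close>

lemma shortest_prefix:
  assumes "Suc k \<le> num_ltr_max xs"
  shows "\<exists>L x R. xs = L @ x # R \<and> num_ltr_max L = k \<and> (\<forall>y\<in>set L. y < x)"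
  using assms
proof (induction xs rule: rev_induct)
  case Nil
  then show ?case by auto
next
  case (snoc x xs)
  show ?case
  proof (cases "Suc k \<le> num_ltr_max xs")
    case True
    then show ?thesis using snoc by fastforce
  next
    case False
    then have "num_ltr_max xs = k" "\<forall>y\<in>set xs. y < x"
      using snoc.prems by (auto simp: num_ltr_max_snoc split: if_splits)
    then show ?thesis by blast
  qed
qed

section \<open>Pattern avoidance\<close>

text \<open>The pattern becomes an order condition on the values of a triple. Without flattening,
  avoidance splits into cases when one entry is inserted.\<close>

definition avoids_rel :: "('a \<Rightarrow> 'a \<Rightarrow> 'a \<Rightarrow> bool) \<Rightarrow> 'a list \<Rightarrow> bool" where
  "avoids_rel P xs \<longleftrightarrow> (\<forall>a b c. subseq [a, b, c] xs \<longrightarrow> \<not> P a b c)"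

lemma subseq2_Cons: "subseq [a, b] (x # xs) \<longleftrightarrow> a = x \<and> b \<in> set xs \<or> subseq [a, b] xs"
  by (cases "a = x") (auto simp: subseq_singleton_left dest: subseq_Cons')

lemma subseq3_Cons:
  "subseq [a, b, c] (x # xs) \<longleftrightarrow> a = x \<and> subseq [b, c] xs \<or> subseq [a, b, c] xs"
  by (cases "a = x") (auto intro: subseq_Cons')

lemma subseq2_insert:
  "subseq [b, c] (L @ n # R) \<longleftrightarrow>
     subseq [b, c] (L @ R) \<or> b = n \<and> c \<in> set R \<or> c = n \<and> b \<in> set L"
  by (induction L) (auto simp only: subseq2_Cons append_Cons append_Nil list.set insert_iff
      empty_iff set_append Un_iff)

text \<open>The inserted entry takes no part in the triple or plays one of its three roles.\<close>

lemma subseq3_insert: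
  "subseq [a, b, c] (L @ n # R) \<longleftrightarrow>
     subseq [a, b, c] (L @ R) \<or> a = n \<and> subseq [b, c] R \<or>
     b = n \<and> a \<in> set L \<and> c \<in> set R \<or> c = n \<and> subseq [a, b] L"
proof (induction L)
  case Nil
  have "\<not> subseq [a, b] []" by simp
  then show ?case by (auto simp only: append_Nil subseq3_Cons list.set empty_iff)
next
  case (Cons x L)
  show ?case
    unfolding append_Cons subseq3_Cons subseq2_insert subseq2_Cons list.set insert_iff Cons.IH
    by (auto simp only:)
qed

lemma sorted_wrt_iff_subseq: "sorted_wrt Q xs \<longleftrightarrow> (\<forall>a b. subseq [a, b] xs \<longrightarrow> Q a b)"
proof (induction xs)
  case (Cons x xs)
  show ?case unfolding subseq2_Cons sorted_wrt.simps Cons.IH by blast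
qed auto

lemma flatten_eq_map_length_filter:
  assumes "distinct xs"
  shows "flatten xs = map (\<lambda>x. length (filter (\<lambda>y. y \<le> x) xs)) xs"
  using assms by (auto simp: flatten_def simp flip: distinct_card)

lemma flatten_three:
  assumes "a \<noteq> b" "a \<noteq> c" "b \<noteq> c"
  shows "flatten [a, b, c] = [2, 3, 1] \<longleftrightarrow> c < a \<and> a < b"
    and "flatten [a, b, c] = [1, 3, 2] \<longleftrightarrow> a < c \<and> c < b"
    and "flatten [a, b, c] = [2, 1, 3] \<longleftrightarrow> b < a \<and> a < c"
proof -
  have flat: "flatten [a, b, c] = map (\<lambda>x. length (filter (\<lambda>y. y \<le> x) [a, b, c])) [a, b, c]"
    using assms by (intro flatten_eq_map_length_filter) simp
  consider "a < b" "b < c" | "a < c" "c < b" | "b < a" "a < c" | "b < c" "c < a"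
    | "c < a" "a < b" | "c < b" "b < a"
    using assms by linarith
  then have "(flatten [a, b, c] = [2, 3, 1] \<longleftrightarrow> c < a \<and> a < b) \<and>
    (flatten [a, b, c] = [1, 3, 2] \<longleftrightarrow> a < c \<and> c < b) \<and>
    (flatten [a, b, c] = [2, 1, 3] \<longleftrightarrow> b < a \<and> a < c)"
    by cases (simp_all add: flat)
  then show "flatten [a, b, c] = [2, 3, 1] \<longleftrightarrow> c < a \<and> a < b"
    and "flatten [a, b, c] = [1, 3, 2] \<longleftrightarrow> a < c \<and> c < b"
    and "flatten [a, b, c] = [2, 1, 3] \<longleftrightarrow> b < a \<and> a < c"
    by auto
qed

lemma subseq_distinct: "subseq xs ys \<Longrightarrow> distinct ys \<Longrightarrow> distinct xs"
  by (auto simp: subseq_conv_nths distinct_nthsI)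

lemma avoids_iff_avoids_rel:
  assumes "distinct xs"
    and "length \<rho> = 3"
    and "\<And>a b c. a \<noteq> b \<Longrightarrow> a \<noteq> c \<Longrightarrow> b \<noteq> c \<Longrightarrow> flatten [a, b, c] = \<rho> \<longleftrightarrow> P a b c"
  shows "avoids xs \<rho> \<longleftrightarrow> avoids_rel P xs"
proof -
  have "(subseq ys xs \<and> flatten ys = \<rho>) \<longleftrightarrow> (\<exists>a b c. ys = [a, b, c] \<and> subseq [a, b, c] xs \<and> P a b c)" for ys
  proof
    assume *: "subseq ys xs \<and> flatten ys = \<rho>"
    then have "length ys = 3" using assms(2) by (auto simp: flatten_def)
    then obtain a b c where ys: "ys = [a, b, c]"
      by (auto simp: numeral_3_eq_3 length_Suc_conv)
    moreover have "distinct ys" using * assms(1) subseq_distinct by blast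
    ultimately show "\<exists>a b c. ys = [a, b, c] \<and> subseq [a, b, c] xs \<and> P a b c"
      using * assms(3) by auto
  next
    assume "\<exists>a b c. ys = [a, b, c] \<and> subseq [a, b, c] xs \<and> P a b c"
    then obtain a b c where ys: "ys = [a, b, c]" "subseq ys xs" "P a b c" by auto
    moreover have "distinct ys" using ys assms(1) subseq_distinct by blast
    ultimately show "subseq ys xs \<and> flatten ys = \<rho>"
      using assms(3) by auto
  qed
  then show ?thesis unfolding avoids_def avoids_rel_def by blast
qed

lemma avoids_231_iff:
  "distinct xs \<Longrightarrow> avoids xs [2, 3, 1] \<longleftrightarrow> avoids_rel (\<lambda>a b c. c < a \<and> a < b) xs"
  by (rule avoids_iff_avoids_rel[OF _ _ flatten_three(1)]) auto

lemma avoids_132_iff: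
  "distinct xs \<Longrightarrow> avoids xs [1, 3, 2] \<longleftrightarrow> avoids_rel (\<lambda>a b c. a < c \<and> c < b) xs"
  by (rule avoids_iff_avoids_rel[OF _ _ flatten_three(2)]) auto

lemma avoids_213_iff:
  "distinct xs \<Longrightarrow> avoids xs [2, 1, 3] \<longleftrightarrow> avoids_rel (\<lambda>a b c. b < a \<and> a < c) xs"
  by (rule avoids_iff_avoids_rel[OF _ _ flatten_three(3)]) auto

lemma subseq_pair_set: "subseq [a, b] xs \<Longrightarrow> a \<in> set xs \<and> b \<in> set xs"
proof -
  assume "subseq [a, b] xs"
  then have "set [a, b] \<subseteq> set xs" using set_nths_subset by (metis subseq_conv_nths)
  then show ?thesis by simp
qed

lemma avoids_rel_insert:
  "avoids_rel P (L @ n # R) \<longleftrightarrow> avoids_rel P (L @ R) \<and>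
     (\<forall>b c. subseq [b, c] R \<longrightarrow> \<not> P n b c) \<and>
     (\<forall>a\<in>set L. \<forall>c\<in>set R. \<not> P a n c) \<and>
     (\<forall>a b. subseq [a, b] L \<longrightarrow> \<not> P a b n)"
  unfolding avoids_rel_def subseq3_insert by blast

text \<open>Being larger than all other entries, \<open>n\<close> can only act as the middle letter
  3. New occurrences are \<open>a n c\<close> with \<open>c < a\<close>, across the cut.\<close>

lemma avoids_rel_231_insert_max:
  fixes n :: "'a::linorder"
  assumes "distinct (L @ R)" "\<forall>y\<in>set L \<union> set R. y < n"
  shows "avoids_rel (\<lambda>a b c. c < a \<and> a < b) (L @ n # R) \<longleftrightarrow>
    avoids_rel (\<lambda>a b c. c < a \<and> a < b) (L @ R) \<and> (\<forall>l\<in>set L. \<forall>r\<in>set R. l < r)"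
proof -
  have 1: "\<not> (c < n \<and> n < b)" if "subseq [b, c] R" for b c
    using subseq_pair_set[OF that] assms(2) less_asym[of n b] by auto
  have 2: "\<not> (n < a \<and> a < b)" if "subseq [a, b] L" for a b
    using subseq_pair_set[OF that] assms(2) less_asym[of n a] by auto
  have 3: "\<not> (c < a \<and> a < n) \<longleftrightarrow> a < c" if "a \<in> set L" "c \<in> set R" for a c
  proof -
    have "a < n" "a \<noteq> c" using that assms by auto
    then show ?thesis by auto
  qed
  show ?thesis
    unfolding avoids_rel_insert using 1 2 3 by simp
qed

text \<open>Here the letter 3 comes last, so \<open>n\<close> completes an occurrence exactly when
  some pair in \<open>L\<close> is decreasing.\<close>

lemma avoids_rel_213_insert_max:
  fixes n :: "'a::linorder"
  assumes "distinct (L @ R)" "\<forall>y\<in>set L \<union> set R. y < n"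
  shows "avoids_rel (\<lambda>a b c. b < a \<and> a < c) (L @ n # R) \<longleftrightarrow>
    avoids_rel (\<lambda>a b c. b < a \<and> a < c) (L @ R) \<and> sorted_wrt (<) L"
proof -
  have 1: "\<not> (b < n \<and> n < c)" if "subseq [b, c] R" for b c
    using subseq_pair_set[OF that] assms(2) less_asym[of n c] by auto
  have 2: "\<not> (n < a \<and> a < c)" if "a \<in> set L" for a c
    using that assms(2) less_asym[of n a] by auto
  have 3: "\<not> (b < a \<and> a < n) \<longleftrightarrow> a < b" if "subseq [a, b] L" for a b
  proof -
    have "a < n" "a \<noteq> b"
      using subseq_pair_set[OF that] subseq_distinct[OF that] assms by auto
    then show ?thesis by auto
  qed
  show ?thesis
    unfolding avoids_rel_insert sorted_wrt_iff_subseq using 1 2 3 by simp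
qed

text \<open>A first entry can only act as the letter 1, so new occurrences are decreasing pairs
  among the entries above \<open>v\<close>.\<close>

lemma avoids_rel_132_Cons:
  fixes v :: "'a::linorder"
  assumes "distinct (v # xs)"
  shows "avoids_rel (\<lambda>a b c. a < c \<and> c < b) (v # xs) \<longleftrightarrow>
    avoids_rel (\<lambda>a b c. a < c \<and> c < b) xs \<and> sorted_wrt (<) (filter ((<) v) xs)"
proof -
  have pair: "subseq [a, b] (filter ((<) v) xs) \<longleftrightarrow> subseq [a, b] xs \<and> v < a \<and> v < b" for a b
  proof
    assume *: "subseq [a, b] (filter ((<) v) xs)"
    then show "subseq [a, b] xs \<and> v < a \<and> v < b"
      using subseq_pair_set[OF *] subseq_order.trans[OF * subseq_filter_left] by auto
  next
    assume "subseq [a, b] xs \<and> v < a \<and> v < b"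
    then show "subseq [a, b] (filter ((<) v) xs)"
      using subseq_filter[of "[a, b]" xs "(<) v"] by simp
  qed
  have "a \<noteq> b" if "subseq [a, b] xs" for a b
    using subseq_distinct[OF that] assms(1) by auto
  then have *: "sorted_wrt (<) (filter ((<) v) xs) \<longleftrightarrow>
    (\<forall>a b. subseq [a, b] xs \<longrightarrow> \<not> (v < b \<and> b < a))"
    unfolding sorted_wrt_iff_subseq pair by (meson linorder_neqE order_less_asym order_less_trans)
  show ?thesis
    unfolding * avoids_rel_def subseq3_Cons by auto
qed

section \<open>Deleting an entry of an avoider\<close>

text \<open>\<open>ok L R\<close> says that the largest entry may be inserted at this cut.
  Surjectivity of the deletion comes from \<open>split\<close>, injectivity from
  \<open>unique\<close>: two nested admissible cuts whose left parts have equally many maxima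
  coincide.\<close>

lemma card_avoiders_Suc_delete_max:
  assumes insert: "\<And>L R n. distinct (L @ R) \<Longrightarrow> \<forall>y\<in>set L \<union> set R. y < n \<Longrightarrow>
      avoids (L @ n # R) \<rho> \<longleftrightarrow> avoids (L @ R) \<rho> \<and> ok L R"
    and split: "\<And>xs k. distinct xs \<Longrightarrow> avoids xs \<rho> \<Longrightarrow> k \<le> num_ltr_max xs \<Longrightarrow>
      \<exists>L R. xs = L @ R \<and> num_ltr_max L = k \<and> ok L R"
    and unique: "\<And>L M R. ok L (M @ R) \<Longrightarrow> ok (L @ M) R \<Longrightarrow>
      num_ltr_max (L @ M) = num_ltr_max L \<Longrightarrow> M = []"
  shows "card {\<pi> \<in> avoiders \<rho> (Suc N). num_ltr_max \<pi> = Suc k} =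
    card {\<sigma> \<in> avoiders \<rho> N. k \<le> num_ltr_max \<sigma>}" (is "card ?A = card ?B")
proof (rule bij_betw_same_card[of "remove1 (Suc N)"])
  have decomp: "\<exists>L R. \<pi> = L @ Suc N # R \<and> remove1 (Suc N) \<pi> = L @ R \<and> L @ R \<in> perms N \<and>
      avoids (L @ R) \<rho> \<and> ok L R \<and> num_ltr_max L = k" if "\<pi> \<in> ?A" for \<pi>
  proof -
    from that have p: "set \<pi> = {1..Suc N}" "distinct \<pi>" "avoids \<pi> \<rho>" "num_ltr_max \<pi> = Suc k"
      by (auto simp: avoiders_def perms_iff)
    then have "Suc N \<in> set \<pi>" by simp
    then obtain L R where \<pi>: "\<pi> = L @ Suc N # R" by (meson split_list)
    with p have "set (L @ R) = {1..Suc N} - {Suc N}" by auto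
    moreover have "{1..Suc N} - {Suc N} = {1..N}" by auto
    ultimately have s: "set (L @ R) = {1..N}" by (simp only:)
    moreover have d: "distinct (L @ R)" using p \<pi> by auto
    moreover have lt: "\<forall>y\<in>set L \<union> set R. y < Suc N" using s by auto
    moreover have "remove1 (Suc N) \<pi> = L @ R" using \<pi> p(2) by (auto simp: remove1_append)
    moreover have "num_ltr_max L = k"
      using num_ltr_max_insert_max[of L R "Suc N"] lt p(4) \<pi> by auto
    ultimately show ?thesis
      using \<pi> p(3) insert[OF d lt] by (auto simp: perms_iff)
  qed
  show "bij_betw (remove1 (Suc N)) ?A ?B"
  proof (rule bij_betwI')
    fix \<pi> \<pi>' assume *: "\<pi> \<in> ?A" "\<pi>' \<in> ?A"
    obtain L R where
      1: "\<pi> = L @ Suc N # R" "remove1 (Suc N) \<pi> = L @ R" "ok L R" "num_ltr_max L = k"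
      using decomp[OF *(1)] by blast
    obtain L' R' where
      2: "\<pi>' = L' @ Suc N # R'" "remove1 (Suc N) \<pi>' = L' @ R'" "ok L' R'" "num_ltr_max L' = k"
      using decomp[OF *(2)] by blast
    show "remove1 (Suc N) \<pi> = remove1 (Suc N) \<pi>' \<longleftrightarrow> \<pi> = \<pi>'"
    proof
      assume "remove1 (Suc N) \<pi> = remove1 (Suc N) \<pi>'"
      then have "L @ R = L' @ R'" using 1 2 by simp
      \<comment> \<open>Two cuts of the same list are nested, with \<open>M\<close> the piece
        between them.\<close>
      then obtain M where "L = L' @ M \<and> M @ R = R' \<or> L @ M = L' \<and> R = M @ R'"
        by (auto simp: append_eq_append_conv2)
      then have "L = L' \<and> R = R'"
        using unique[of L M R'] unique[of L' M R] 1 2 by auto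
      then show "\<pi> = \<pi>'" using 1 2 by simp
    qed auto
  next
    fix \<pi> assume *: "\<pi> \<in> ?A"
    obtain L R where "remove1 (Suc N) \<pi> = L @ R" "L @ R \<in> perms N"
      "avoids (L @ R) \<rho>" "num_ltr_max L = k"
      using decomp[OF *] by blast
    \<comment> \<open>The bound k holds because the k maxima of the prefix \<open>L\<close> remain
      maxima in \<open>L @ R\<close>.\<close>
    then show "remove1 (Suc N) \<pi> \<in> ?B"
      using num_ltr_max_mono[of L R] by (auto simp: avoiders_def)
  next
    fix \<sigma> assume "\<sigma> \<in> ?B"
    then have s: "set \<sigma> = {1..N}" "distinct \<sigma>" "avoids \<sigma> \<rho>" "k \<le> num_ltr_max \<sigma>"
      by (auto simp: avoiders_def perms_iff)
    then obtain L R where LR: "\<sigma> = L @ R" "num_ltr_max L = k" "ok L R"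
      using split by blast
    have "set L \<union> set R = {1..N}" using s LR by auto
    then have lt: "\<forall>y\<in>set L \<union> set R. y < Suc N" by auto
    have "Suc N \<notin> set L" "Suc N \<notin> set R"
      using \<open>set L \<union> set R = {1..N}\<close> by (metis Un_iff atLeastAtMost_iff not_less_eq_eq order_refl)+
    then have "L @ Suc N # R \<in> ?A"
      using s LR lt insert[of L R "Suc N"] num_ltr_max_insert_max[of L R "Suc N"]
      by (auto simp: avoiders_def perms_iff)
    moreover have "remove1 (Suc N) (L @ Suc N # R) = \<sigma>"
      using lt LR by (auto simp: remove1_append)
    ultimately show "\<exists>\<pi>\<in>?A. \<sigma> = remove1 (Suc N) \<pi>" by metis
  qed
qed

text \<open>An admissible cut has all of \<open>L\<close> below all of \<open>R\<close>. Moving it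
  to the right past at least one entry passes a new maximum, which gives uniqueness.\<close>

lemma card_avoiders_231_Suc:
  "card {\<pi> \<in> avoiders [2, 3, 1] (Suc N). num_ltr_max \<pi> = Suc k} =
    card {\<sigma> \<in> avoiders [2, 3, 1] N. k \<le> num_ltr_max \<sigma>}"
proof (rule card_avoiders_Suc_delete_max[where ok = "\<lambda>L R. \<forall>l\<in>set L. \<forall>r\<in>set R. l < r"])
  fix L R :: "nat list" and n
  assume *: "distinct (L @ R)" "\<forall>y\<in>set L \<union> set R. y < n"
  then have d: "distinct (L @ n # R)" by auto
  show "avoids (L @ n # R) [2, 3, 1] \<longleftrightarrow> avoids (L @ R) [2, 3, 1] \<and> (\<forall>l\<in>set L. \<forall>r\<in>set R. l < r)"
    unfolding avoids_231_iff[OF d] avoids_231_iff[OF *(1)] by (rule avoids_rel_231_insert_max[OF *])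
next
  fix xs k assume xs: "distinct xs" "avoids xs [2, 3, 1]" "k \<le> num_ltr_max xs"
  then obtain L R where LR: "xs = L @ R" "num_ltr_max L = k" "R = [] \<or> (\<forall>y\<in>set L. y < hd R)"
    using longest_prefix by blast
  \<comment> \<open>With \<open>m\<close> the head of \<open>R\<close>, the choice of the cut gives
    \<open>l < m\<close>; if \<open>r < l\<close>, then \<open>l m r\<close> is an occurrence of
    231.\<close>
  have "l < r" if "l \<in> set L" "r \<in> set R" for l r
  proof (rule ccontr)
    assume "\<not> l < r"
    moreover have "l \<noteq> r" using xs(1) LR(1) that by auto
    moreover have "R \<noteq> []" using that(2) by auto
    then obtain m R' where R: "R = m # R'" by (meson neq_Nil_conv)
    ultimately have "l < m" "r < l" using LR(3) that(1) by auto
    moreover have "r \<in> set R'" using that(2) R \<open>l < m\<close> \<open>r < l\<close> by auto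
    then have "subseq [l, m, r] xs"
      unfolding LR(1) R using that(1) by (simp add: subseq3_insert)
    ultimately show False
      using xs(2) unfolding avoids_231_iff[OF xs(1)] avoids_rel_def by blast
  qed
  then show "\<exists>L R. xs = L @ R \<and> num_ltr_max L = k \<and> (\<forall>l\<in>set L. \<forall>r\<in>set R. l < r)"
    using LR by blast
next
  fix L M R :: "nat list"
  assume ok: "\<forall>l\<in>set L. \<forall>r\<in>set (M @ R). l < r" and eq: "num_ltr_max (L @ M) = num_ltr_max L"
  show "M = []"
  proof (rule ccontr)
    assume "M \<noteq> []"
    then obtain m M' where M: "M = m # M'" by (cases M) auto
    have "num_ltr_max (L @ [m]) = Suc (num_ltr_max L)"
      using ok M by (simp add: num_ltr_max_snoc)
    then show False
      using num_ltr_max_mono[of "L @ [m]" M'] eq M by simp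
  qed
qed

text \<open>An admissible cut has \<open>L\<close> increasing. Then each entry of \<open>L\<close>
  is a maximum, so k is the length of \<open>L\<close> and determines the cut.\<close>

lemma card_avoiders_213_Suc:
  "card {\<pi> \<in> avoiders [2, 1, 3] (Suc N). num_ltr_max \<pi> = Suc k} =
    card {\<sigma> \<in> avoiders [2, 1, 3] N. k \<le> num_ltr_max \<sigma>}"
proof (rule card_avoiders_Suc_delete_max[where ok = "\<lambda>L R. sorted_wrt (<) L"])
  fix L R :: "nat list" and n
  assume *: "distinct (L @ R)" "\<forall>y\<in>set L \<union> set R. y < n"
  then have d: "distinct (L @ n # R)" by auto
  show "avoids (L @ n # R) [2, 1, 3] \<longleftrightarrow> avoids (L @ R) [2, 1, 3] \<and> sorted_wrt (<) L"
    unfolding avoids_213_iff[OF d] avoids_213_iff[OF *(1)] by (rule avoids_rel_213_insert_max[OF *])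
next
  fix xs k assume xs: "distinct xs" "avoids xs [2, 1, 3]" "k \<le> num_ltr_max xs"
  show "\<exists>L R. xs = L @ R \<and> num_ltr_max L = k \<and> sorted_wrt (<) L"
  proof (cases k)
    case 0
    then show ?thesis by (intro exI[of _ "[]"] exI[of _ xs]) simp
  next
    case (Suc k')
    then obtain L x R where LR: "xs = L @ x # R" "num_ltr_max L = k'" "\<forall>y\<in>set L. y < x"
      using shortest_prefix xs(3) by blast
    \<comment> \<open>A decreasing pair of \<open>L\<close> followed by the larger \<open>x\<close>
      would be an occurrence of 213.\<close>
    have "a < b" if "subseq [a, b] L" for a b
    proof (rule ccontr)
      assume "\<not> a < b"
      moreover have "a \<noteq> b" using subseq_distinct[OF that] xs(1) LR(1) by auto
      moreover have "a < x" using LR(3) subseq_pair_set[OF that] by auto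
      moreover have "subseq [a, b, x] xs" using that by (simp add: LR(1) subseq3_insert)
      ultimately show False
        using xs(2) unfolding avoids_213_iff[OF xs(1)] avoids_rel_def by (metis linorder_cases)
    qed
    then have "sorted_wrt (<) L" by (auto simp: sorted_wrt_iff_subseq)
    then have "sorted_wrt (<) (L @ [x])" using LR(3) by (simp add: sorted_wrt_append)
    moreover have "num_ltr_max (L @ [x]) = k" using LR Suc by (simp add: num_ltr_max_snoc)
    ultimately show ?thesis using LR(1) by (intro exI[of _ "L @ [x]"] exI[of _ R]) simp
  qed
next
  fix L M R :: "nat list"
  assume "sorted_wrt (<) L" "sorted_wrt (<) (L @ M)" "num_ltr_max (L @ M) = num_ltr_max L"
  then show "M = []" by (auto simp: num_ltr_max_sorted)
qed

section \<open>The pattern 132: deleting the first entry\<close>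

text \<open>Entries below \<open>v\<close> are hidden by it, and those above \<open>v\<close> come
  in increasing order, so each of them is a new maximum.\<close>

lemma num_ltr_max_Cons_sorted:
  assumes "distinct xs" "sorted_wrt (<) (filter ((<) v) xs)"
  shows "num_ltr_max (v # xs) = Suc (card {y \<in> set xs. v < y})"
  using assms
proof (induction xs rule: rev_induct)
  case Nil
  show ?case using num_ltr_max_snoc[of "[]" v] by simp
next
  case (snoc x xs)
  have IH: "num_ltr_max (v # xs) = Suc (card {y \<in> set xs. v < y})"
    using snoc by (simp add: sorted_wrt_append)
  have num: "num_ltr_max (v # xs @ [x]) =
      num_ltr_max (v # xs) + (if \<forall>y\<in>set (v # xs). y < x then 1 else 0)"
    using num_ltr_max_snoc[of "v # xs" x] by simp
  show ?case
  proof (cases "v < x")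
    case True
    then have "\<forall>y\<in>set (filter ((<) v) xs). y < x"
      using snoc.prems(2) by (simp add: sorted_wrt_append)
    with True have "\<forall>y\<in>set (v # xs). y < x"
      by (auto simp: not_less intro: le_less_trans)
    moreover have "{y \<in> set (xs @ [x]). v < y} = insert x {y \<in> set xs. v < y}"
      using True by auto
    moreover have "x \<notin> {y \<in> set xs. v < y}" using snoc.prems(1) by simp
    ultimately show ?thesis by (simp add: num IH)
  next
    case False
    then have "{y \<in> set (xs @ [x]). v < y} = {y \<in> set xs. v < y}" by auto
    with False show ?thesis by (simp add: num IH)
  qed
qed

text \<open>The key to 132. If \<open>x\<close> is the first entry of \<open>xs\<close>, the number
  of maxima is the number of entries that are at least \<open>x\<close>. The inequality thus
  compares the sizes of two upper sets of a chain, which amounts to inclusion: every entry above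
  \<open>v\<close> is at least \<open>x\<close>. The entries above \<open>x\<close> increase by
  avoidance.\<close>

lemma card_greater_le_num_ltr_max_iff:
  fixes v :: nat
  assumes "distinct xs" "avoids_rel (\<lambda>a b c. a < c \<and> c < b) xs"
  shows "card {y \<in> set xs. v < y} \<le> num_ltr_max xs \<longleftrightarrow> sorted_wrt (<) (filter ((<) v) xs)"
proof (cases xs)
  case Nil
  then show ?thesis by simp
next
  case (Cons x ys)
  then have ys: "distinct ys" "x \<notin> set ys" "sorted_wrt (<) (filter ((<) x) ys)"
    using assms avoids_rel_132_Cons[of x ys] by auto
  have "{y \<in> set xs. x \<le> y} = insert x {y \<in> set ys. x < y}"
    using ys(2) by (auto simp: Cons le_less)
  then have num: "num_ltr_max xs = card {y \<in> set xs. x \<le> y}"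
    using num_ltr_max_Cons_sorted[OF ys(1,3)] by (simp add: Cons)
  show ?thesis
  proof
    assume sorted: "sorted_wrt (<) (filter ((<) v) xs)"
    \<comment> \<open>Otherwise \<open>x\<close>, \<open>y\<close> would be a decreasing pair of
      entries above \<open>v\<close>.\<close>
    have "x \<le> y" if "y \<in> set xs" "v < y" for y
    proof (rule ccontr)
      assume "\<not> x \<le> y"
      then have "v < x" "y \<in> set ys" using that by (auto simp: Cons)
      then have "x < y" using sorted that by (simp add: Cons)
      with \<open>\<not> x \<le> y\<close> show False by simp
    qed
    then show "card {y \<in> set xs. v < y} \<le> num_ltr_max xs"
      unfolding num by (intro card_mono) auto
  next
    assume le: "card {y \<in> set xs. v < y} \<le> num_ltr_max xs"
    \<comment> \<open>An entry \<open>y\<close> with \<open>v < y < x\<close> would make the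
      inclusion of the upper sets strict and contradict \<open>le\<close>.\<close>
    have min: "x \<le> y" if "y \<in> set xs" "v < y" for y
    proof (rule ccontr)
      assume "\<not> x \<le> y"
      then have "{y \<in> set xs. x \<le> y} \<subset> {y \<in> set xs. v < y}" using that by auto
      then have "card {y \<in> set xs. x \<le> y} < card {y \<in> set xs. v < y}"
        by (intro psubset_card_mono) auto
      with le num show False by simp
    qed
    have lt: "x < y" if "y \<in> set ys" "v < y" for y
      using min[of y] that ys(2) by (auto simp: Cons le_less)
    then have "filter ((<) v) ys = filter ((<) v) (filter ((<) x) ys)"
      by (auto intro!: filter_cong)
    then have "sorted_wrt (<) (filter ((<) v) ys)"
      using ys(3) by (metis sorted_wrt_filter)
    then show "sorted_wrt (<) (filter ((<) v) xs)"
      using lt by (simp add: Cons)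
  qed
qed

text \<open>An arbitrary finite set of entries makes relabelling after deletion unnecessary.\<close>
definition avoiders_132_on :: "nat set \<Rightarrow> nat list set" where
  "avoiders_132_on S =
     {\<pi>. set \<pi> = S \<and> distinct \<pi> \<and> avoids_rel (\<lambda>a b c. a < c \<and> c < b) \<pi>}"

text \<open>Supplies, for each k below \<open>card S\<close>, the only element with exactly k larger
  ones; it is the forced first entry.\<close>

lemma bij_betw_card_greater:
  fixes S :: "'a::linorder set"
  assumes "finite S"
  shows "bij_betw (\<lambda>v. card {y \<in> S. v < y}) S {..<card S}"
proof -
  have lt: "card {y \<in> S. w < y} < card {y \<in> S. v < y}" if "v < w" "w \<in> S" for v w
    using that assms by (intro psubset_card_mono) auto
  have inj: "inj_on (\<lambda>v. card {y \<in> S. v < y}) S"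
  proof (rule inj_onI)
    fix v w assume "v \<in> S" "w \<in> S" "card {y \<in> S. v < y} = card {y \<in> S. w < y}"
    then show "v = w" using lt[of v w] lt[of w v] by (cases v w rule: linorder_cases) auto
  qed
  have "(\<lambda>v. card {y \<in> S. v < y}) ` S \<subseteq> {..<card S}"
    using assms by (auto intro!: psubset_card_mono)
  then have "(\<lambda>v. card {y \<in> S. v < y}) ` S = {..<card S}"
    using card_image[OF inj] by (intro card_subset_eq) auto
  with inj show ?thesis by (simp add: bij_betw_def)
qed

text \<open>With k + 1 maxima the first entry has exactly k larger elements in \<open>S\<close>,
  hence is \<open>v\<close>. The sortedness condition on the rest then becomes the bound by
  k.\<close>

lemma avoiders_132_on_Suc:
  assumes v: "v \<in> S" "card {y \<in> S. v < y} = k" and "finite S"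
  shows "{\<pi> \<in> avoiders_132_on S. num_ltr_max \<pi> = Suc k} =
    (#) v ` {\<sigma> \<in> avoiders_132_on (S - {v}). k \<le> num_ltr_max \<sigma>}"
proof (intro equalityI subsetI)
  fix \<pi> assume "\<pi> \<in> {\<pi> \<in> avoiders_132_on S. num_ltr_max \<pi> = Suc k}"
  then have \<pi>: "set \<pi> = S" "distinct \<pi>" "avoids_rel (\<lambda>a b c. a < c \<and> c < b) \<pi>"
    "num_ltr_max \<pi> = Suc k"
    by (auto simp: avoiders_132_on_def)
  then obtain w \<sigma> where w: "\<pi> = w # \<sigma>" by (cases \<pi>) auto
  then have \<sigma>: "distinct \<sigma>" "avoids_rel (\<lambda>a b c. a < c \<and> c < b) \<sigma>"
    "sorted_wrt (<) (filter ((<) w) \<sigma>)"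
    using \<pi> avoids_rel_132_Cons[of w \<sigma>] by auto
  have set: "{y \<in> set \<sigma>. w < y} = {y \<in> S. w < y}" using \<pi>(1) w by auto
  then have "card {y \<in> S. w < y} = k"
    using num_ltr_max_Cons_sorted[OF \<sigma>(1,3)] \<pi>(4) w by simp
  moreover have "w \<in> S" using \<pi>(1) w by auto
  ultimately have "w = v"
    using bij_betw_card_greater[OF \<open>finite S\<close>] v by (auto simp: bij_betw_def dest: inj_onD)
  moreover have "k \<le> num_ltr_max \<sigma>"
    using card_greater_le_num_ltr_max_iff[OF \<sigma>(1,2), of w] \<sigma>(3) set \<open>w = v\<close> v(2) by simp
  moreover have "set \<sigma> = S - {w}" using \<pi>(1,2) w by auto
  ultimately show "\<pi> \<in> (#) v ` {\<sigma> \<in> avoiders_132_on (S - {v}). k \<le> num_ltr_max \<sigma>}"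
    using \<sigma> w by (auto simp: avoiders_132_on_def)
next
  fix \<pi> assume "\<pi> \<in> (#) v ` {\<sigma> \<in> avoiders_132_on (S - {v}). k \<le> num_ltr_max \<sigma>}"
  then obtain \<sigma> where \<pi>: "\<pi> = v # \<sigma>" and \<sigma>: "set \<sigma> = S - {v}" "distinct \<sigma>"
    "avoids_rel (\<lambda>a b c. a < c \<and> c < b) \<sigma>" "k \<le> num_ltr_max \<sigma>"
    by (auto simp: avoiders_132_on_def)
  have "{y \<in> set \<sigma>. v < y} = {y \<in> S. v < y}" using \<sigma>(1) by auto
  then have k: "card {y \<in> set \<sigma>. v < y} = k" using v(2) by simp
  then have "sorted_wrt (<) (filter ((<) v) \<sigma>)"
    using card_greater_le_num_ltr_max_iff[OF \<sigma>(2,3), of v] \<sigma>(4) by simp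
  moreover have "distinct \<pi>" using \<sigma> \<pi> by simp
  moreover have "set \<pi> = S" using \<sigma>(1) \<pi> v(1) by auto
  ultimately show "\<pi> \<in> {\<pi> \<in> avoiders_132_on S. num_ltr_max \<pi> = Suc k}"
    using avoids_rel_132_Cons[of v \<sigma>] num_ltr_max_Cons_sorted[OF \<sigma>(2), of v] \<sigma>(3) k \<pi>
    by (simp add: avoiders_132_on_def)
qed

section \<open>Ballot numbers\<close>

text \<open>The Catalan triangle, defined by the recursion that the deletions yield. The sum may
  stop at \<open>n\<close> because a list of \<open>n\<close> entries has at most \<open>n\<close>
  maxima.\<close>

fun ballot :: "nat \<Rightarrow> nat \<Rightarrow> nat" where
  "ballot 0 k = (if k = 0 then 1 else 0)"
| "ballot (Suc n) 0 = 0"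
| "ballot (Suc n) (Suc k) = (\<Sum>j = k..n. ballot n j)"

lemma card_le_eq_sum_card:
  fixes f :: "'a \<Rightarrow> nat"
  assumes "finite A" "\<And>x. x \<in> A \<Longrightarrow> f x \<le> n"
  shows "card {x \<in> A. k \<le> f x} = (\<Sum>j = k..n. card {x \<in> A. f x = j})"
proof -
  have "{x \<in> A. k \<le> f x} = (\<Union>j\<in>{k..n}. {x \<in> A. f x = j})"
    using assms(2) by auto
  then show ?thesis
    using assms(1) by (simp, subst card_UN_disjoint) auto
qed

lemma card_avoiders_132_on:
  assumes "finite S"
  shows "card {\<pi> \<in> avoiders_132_on S. num_ltr_max \<pi> = k} = ballot (card S) k"
  using assms
proof (induction "card S" arbitrary: S k)
  case 0
  then have "S = {}" by simp
  then have "avoiders_132_on S = {[]}" by (auto simp: avoiders_132_on_def avoids_rel_def)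
  moreover have "{\<pi>. \<pi> = [] \<and> num_ltr_max \<pi> = k} = (if k = 0 then {[]} else {})" by auto
  ultimately show ?case by (simp add: \<open>S = {}\<close>)
next
  case (Suc n)
  have length: "length \<pi> = card S'" if "\<pi> \<in> avoiders_132_on S'" for \<pi> S'
    using that by (auto simp: avoiders_132_on_def distinct_card)
  show ?case
  proof (cases k)
    case 0
    have "num_ltr_max \<pi> > 0" if "\<pi> \<in> avoiders_132_on S" for \<pi>
      using length[OF that] Suc.hyps(2) by (intro num_ltr_max_pos) auto
    then have empty: "{\<pi> \<in> avoiders_132_on S. num_ltr_max \<pi> = k} = {}" using 0 by auto
    show ?thesis unfolding empty by (simp add: 0 flip: Suc.hyps(2))
  next
    case (Suc j)
    show ?thesis
    proof (cases "j \<le> n")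
      case True
      then have "j \<in> (\<lambda>v. card {y \<in> S. v < y}) ` S"
        using bij_betw_card_greater[OF Suc.prems] Suc.hyps(2) by (auto simp: bij_betw_def)
      then obtain v where v: "v \<in> S" "card {y \<in> S. v < y} = j" by auto
      let ?A = "avoiders_132_on (S - {v})"
      have n: "n = card (S - {v})" using v Suc.hyps(2) Suc.prems by simp
      have fin: "finite ?A"
        by (rule finite_subset[OF _ finite_lists_length_eq[OF Suc.prems, of n]])
          (use length n in \<open>auto simp: avoiders_132_on_def\<close>)
      have le: "num_ltr_max \<sigma> \<le> n" if "\<sigma> \<in> ?A" for \<sigma>
        using num_ltr_max_le_length[of \<sigma>] length[OF that] n by simp
      have "card {\<pi> \<in> avoiders_132_on S. num_ltr_max \<pi> = k} =
          card {\<sigma> \<in> ?A. j \<le> num_ltr_max \<sigma>}"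
        unfolding Suc avoiders_132_on_Suc[OF v Suc.prems] by (simp add: card_image)
      also have "\<dots> = (\<Sum>i = j..n. card {\<sigma> \<in> ?A. num_ltr_max \<sigma> = i})"
        by (rule card_le_eq_sum_card[OF fin le])
      also have "\<dots> = (\<Sum>i = j..n. ballot n i)"
        using Suc.hyps(1)[OF n] Suc.prems n by simp
      finally show ?thesis by (simp add: Suc flip: Suc.hyps(2))
    next
      case False
      have "num_ltr_max \<pi> \<noteq> k" if "\<pi> \<in> avoiders_132_on S" for \<pi>
        using num_ltr_max_le_length[of \<pi>] length[OF that] Suc.hyps(2) False Suc by simp
      then have empty: "{\<pi> \<in> avoiders_132_on S. num_ltr_max \<pi> = k} = {}" by auto
      show ?thesis unfolding empty using False by (simp add: Suc flip: Suc.hyps(2))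
    qed
  qed
qed

lemma card_avoiders_ballot_if:
  assumes Suc: "\<And>N k. card {\<pi> \<in> avoiders \<rho> (Suc N). num_ltr_max \<pi> = Suc k} =
      card {\<sigma> \<in> avoiders \<rho> N. k \<le> num_ltr_max \<sigma>}"
    and "avoids [] \<rho>"
  shows "card {\<pi> \<in> avoiders \<rho> N. num_ltr_max \<pi> = k} = ballot N k"
proof (induction N arbitrary: k)
  case 0
  have "avoiders \<rho> 0 = {[]}" using assms(2) by (auto simp: avoiders_def perms_iff)
  moreover have "{\<pi>. \<pi> = [] \<and> num_ltr_max \<pi> = k} = (if k = 0 then {[]} else {})" by auto
  ultimately show ?case by simp
next
  case (Suc N)
  have le: "num_ltr_max \<sigma> \<le> N" if "\<sigma> \<in> avoiders \<rho> N" for \<sigma>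
    using num_ltr_max_le_length[of \<sigma>] that perms_length by (auto simp: avoiders_def)
  show ?case
  proof (cases k)
    case 0
    have "num_ltr_max \<pi> > 0" if "\<pi> \<in> avoiders \<rho> (Suc N)" for \<pi>
      using that by (intro num_ltr_max_pos) (auto simp: avoiders_def perms_iff)
    then have empty: "{\<pi> \<in> avoiders \<rho> (Suc N). num_ltr_max \<pi> = k} = {}" using 0 by auto
    show ?thesis unfolding empty by (simp add: 0)
  next
    case (Suc j)
    have "card {\<sigma> \<in> avoiders \<rho> N. j \<le> num_ltr_max \<sigma>} =
        (\<Sum>i = j..N. card {\<sigma> \<in> avoiders \<rho> N. num_ltr_max \<sigma> = i})"
      by (rule card_le_eq_sum_card[OF finite_avoiders le])
    then show ?thesis unfolding Suc assms(1) Suc.IH by simp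
  qed
qed

lemma card_avoiders_num_ltr_max:
  assumes "\<rho> \<in> {[2, 3, 1], [1, 3, 2], [2, 1, 3]}"
  shows "card {\<pi> \<in> avoiders \<rho> N. num_ltr_max \<pi> = k} = ballot N k"
proof -
  have "avoids_rel P []" for P :: "nat \<Rightarrow> nat \<Rightarrow> nat \<Rightarrow> bool" by (simp add: avoids_rel_def)
  moreover have distinct_nil: "distinct ([] :: nat list)" by simp
  ultimately have Nil: "avoids [] [2, 3, 1]" "avoids [] [2, 1, 3]"
    by (simp_all only: avoids_231_iff[OF distinct_nil]
        avoids_213_iff[OF distinct_nil])
  consider "\<rho> = [2, 3, 1]" | "\<rho> = [1, 3, 2]" | "\<rho> = [2, 1, 3]" using assms by auto
  then show ?thesis
  proof cases
    case 1
    show ?thesis unfolding 1 by (rule card_avoiders_ballot_if[OF card_avoiders_231_Suc Nil(1)])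
  next
    case 2
    have "avoiders [1, 3, 2] N = avoiders_132_on {1..N}"
      unfolding avoiders_def avoiders_132_on_def perms_iff using avoids_132_iff by blast
    then show ?thesis using card_avoiders_132_on[of "{1..N}" k] 2 by simp
  next
    case 3
    show ?thesis unfolding 3 by (rule card_avoiders_ballot_if[OF card_avoiders_213_Suc Nil(2)])
  qed
qed

text \<open>Written additively, with \<open>Suc m\<close> for the size, to avoid truncated
  subtraction. The recursion sum gives
  \<open>ballot (n+1) k = ballot n (k-1) + ballot (n+1) (k+1)\<close>, which matches Pascal's rule;
  hence the inner induction goes downwards in \<open>k\<close>.\<close>

lemma ballot_add_binomial:
  assumes "k \<le> Suc m"
  shows "ballot (Suc m) k + ((2 * m + 1 - k) choose Suc m) = (2 * m + 1 - k) choose m"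
  using assms
proof (induction m arbitrary: k)
  case 0
  then have "k = 0 \<or> k = 1" by auto
  then show ?case by auto
next
  case (Suc m)
  from Suc.prems show ?case
  proof (induction k rule: inc_induct)
    case base
    have "ballot (Suc (Suc m)) (Suc (Suc m)) = ballot (Suc m) (Suc m)" by simp
    then show ?case using Suc.IH[of "Suc m"] by (simp add: binomial_eq_0)
  next
    case (step k)
    show ?case
    proof (cases k)
      case 0
      \<comment> \<open>In column 0 the ballot number is 0, and the two binomials are the two equal
        middle ones of an odd row.\<close>
      have "(2 * Suc m + 1) choose Suc m = (2 * Suc m + 1) choose Suc (Suc m)"
        using binomial_symmetric[of "Suc m" "2 * Suc m + 1"] by simp
      then show ?thesis by (simp add: 0)
    next
      case (Suc j)
      then have j: "j \<le> m" using step by simp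
      define t where "t = 2 * m + 1 - j"
      have t: "2 * Suc m + 1 - k = Suc t" "2 * Suc m + 1 - Suc k = t" "2 * m + 1 - j = t"
        using j by (auto simp: t_def Suc)
      \<comment> \<open>The sum from \<open>Suc j\<close> on is the recursion sum of the next column
        \<open>Suc k\<close>.\<close>
      have "{j..Suc m} = insert j {Suc j..Suc m}" using j by auto
      then have "ballot (Suc (Suc m)) k = ballot (Suc m) j + ballot (Suc (Suc m)) (Suc k)"
        unfolding Suc ballot.simps(3) by simp
      moreover have "ballot (Suc m) j + (t choose Suc m) = t choose m"
        using Suc.IH[of j] j t by simp
      moreover have "ballot (Suc (Suc m)) (Suc k) + (t choose Suc (Suc m)) = t choose Suc m"
        using step.IH unfolding t .
      ultimately show ?thesis unfolding t binomial_Suc_Suc by simp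
    qed
  qed
qed

text \<open>Multiplied by M = 2N - k, both binomials over M - 1 become multiples of
  \<open>M choose N\<close> by absorption, with coefficients N and M - N; their difference is
  k.\<close>

lemma ballot_closed_form:
  assumes "k \<in> {1..N}"
  shows "real (ballot N k) = real k / real (2 * N - k) * real ((2 * N - k) choose N)"
proof -
  define M where "M = 2 * N - k"
  have M: "M \<ge> N" "N > 0" "k = 2 * N - M" "M \<le> 2 * N" using assms by (auto simp: M_def)
  obtain m where N: "N = Suc m" using M(2) by (cases N) auto
  have "2 * m + 1 - k = M - 1" by (simp add: M_def N)
  then have "real (ballot N k) + real ((M - 1) choose N) = real ((M - 1) choose (N - 1))"
    using ballot_add_binomial[of k m] assms unfolding N by (simp flip: of_nat_add)
  then have "real M * real (ballot N k) + real (M * ((M - 1) choose N)) = real (M * ((M - 1) choose (N - 1)))"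
    by (simp flip: distrib_left)
  moreover have "M * ((M - 1) choose N) = (M - N) * (M choose N)"
    by (rule binomial_absorb_comp[symmetric])
  moreover have "M * ((M - 1) choose (N - 1)) = N * (M choose N)"
    using times_binomial_minus1_eq[OF M(2)] by simp
  ultimately have "real M * real (ballot N k) + real (M - N) * real (M choose N) =
      real N * real (M choose N)"
    by (simp only: of_nat_mult)
  then have "real M * real (ballot N k) = (real N - real (M - N)) * real (M choose N)"
    by (simp only: left_diff_distrib)
  also have "real N - real (M - N) = real k" using M by simp
  finally show ?thesis using M unfolding M_def[symmetric] by (simp add: field_simps)
qed

section \<open>Catalan numbers, the total count and the expectation\<close>

text \<open>By the recursion the left side is the sum of row \<open>N\<close> of the triangle, so
  this turns row sums into Catalan numbers.\<close>

lemma ballot_1_eq_catalan: "real (ballot (Suc N) 1) = catalan N"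
proof -
  define a b where "a = real ((2 * N + 1) choose Suc N)" and "b = real ((2 * N) choose N)"
  have "Suc N * ((2 * N + 1) choose Suc N) = (2 * N + 1) * ((2 * N) choose N)"
    using times_binomial_minus1_eq[of "Suc N" "2 * N + 1"] by simp
  then have "real (Suc N) * a = real (2 * N + 1) * b"
    unfolding a_def b_def by (simp only: flip: of_nat_mult)
  then have "1 / real (2 * N + 1) * a = 1 / (real N + 1) * b"
    by (simp add: field_simps)
  moreover have "real (ballot (Suc N) 1) = 1 / real (2 * N + 1) * a"
    unfolding a_def using ballot_closed_form[of 1 "Suc N"] by simp
  ultimately show ?thesis by (simp only: catalan_def b_def)
qed

lemma catalan_pos: "catalan N > 0"
  by (simp add: catalan_def zero_less_binomial)

lemma catalan_Suc_ratio: "catalan (Suc N) / catalan N = (4 * real N + 2) / (real N + 2)"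
proof -
  define f b where "f = (fact N :: real)" and "b = (fact (2 * N) :: real)"
  have pos: "f > 0" "b > 0" by (simp_all add: f_def b_def)
  have C: "catalan n = 1 / (real n + 1) * (fact (2 * n) / (fact n * fact n))" for n
    using binomial_fact[of n "2 * n", where 'a = real] by (simp add: catalan_def)
  have "fact (2 * Suc N) = (2 * real N + 2) * (2 * real N + 1) * b"
    by (simp add: algebra_simps b_def)
  moreover have "fact (Suc N) = (real N + 1) * f"
    by (simp add: algebra_simps f_def)
  ultimately have "catalan (Suc N) / catalan N = (1 / (real N + 2) *
      ((2 * real N + 2) * (2 * real N + 1) * b / ((real N + 1) * f * ((real N + 1) * f)))) /
      (1 / (real N + 1) * (b / (f * f)))"
    unfolding C b_def[symmetric] f_def[symmetric] by simp
  also have "2 * real N + 2 = 2 * (real N + 1)" by simp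
  also have "1 / (real N + 2) *
      (2 * (real N + 1) * (2 * real N + 1) * b / ((real N + 1) * f * ((real N + 1) * f))) /
      (1 / (real N + 1) * (b / (f * f))) = 2 * (2 * real N + 1) / (real N + 2)"
    using pos by (simp add: divide_simps) (simp add: algebra_simps)
  finally show ?thesis by (simp add: algebra_simps)
qed

lemma num_ltr_max_avoiders_le: "\<pi> \<in> avoiders \<rho> N \<Longrightarrow> num_ltr_max \<pi> \<le> N"
  using num_ltr_max_le_length[of \<pi>] perms_length by (auto simp: avoiders_def)

lemma card_avoiders_le_num_ltr_max:
  "card {\<pi> \<in> avoiders \<rho> N. k \<le> num_ltr_max \<pi>} =
    (\<Sum>j = k..N. card {\<pi> \<in> avoiders \<rho> N. num_ltr_max \<pi> = j})"
  by (intro card_le_eq_sum_card finite_avoiders num_ltr_max_avoiders_le)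

lemma card_avoiders:
  assumes "\<rho> \<in> {[2, 3, 1], [1, 3, 2], [2, 1, 3]}"
  shows "real (card (avoiders \<rho> N)) = catalan N"
proof -
  \<comment> \<open>The vacuous bound 0 puts the whole set of avoiders into the form of a recursion
    sum.\<close>
  have "card {\<pi> \<in> avoiders \<rho> N. 0 \<le> num_ltr_max \<pi>} = ballot (Suc N) (Suc 0)"
    by (simp only: card_avoiders_le_num_ltr_max card_avoiders_num_ltr_max[OF assms] ballot.simps)
  then show ?thesis using ballot_1_eq_catalan[of N] by simp
qed

text \<open>Double counting of the pairs of an avoider and a k with 0 <= k <= its number of maxima;
  including k = 0 produces the summand 1.\<close>

lemma sum_Suc_num_ltr_max:
  assumes "\<rho> \<in> {[2, 3, 1], [1, 3, 2], [2, 1, 3]}"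
  shows "real (\<Sum>\<pi>\<in>avoiders \<rho> N. num_ltr_max \<pi> + 1) = catalan (Suc N)"
proof -
  let ?A = "avoiders \<rho> N"
  have "ballot (Suc (Suc N)) 1 = (\<Sum>k = 0..Suc N. ballot (Suc N) k)"
    by (simp only: One_nat_def ballot.simps)
  \<comment> \<open>The shift loses nothing because \<open>ballot (Suc N) 0 = 0\<close>.\<close>
  also have "\<dots> = (\<Sum>k = 0..N. ballot (Suc N) (Suc k))"
    by (simp only: sum.atLeast0_atMost_Suc_shift ballot.simps add_0 o_def)
  also have "\<dots> = (\<Sum>k = 0..N. card {\<pi> \<in> ?A. k \<le> num_ltr_max \<pi>})"
    by (simp only: card_avoiders_le_num_ltr_max card_avoiders_num_ltr_max[OF assms] ballot.simps)
  also have "\<dots> = (\<Sum>k = 0..N. \<Sum>\<pi>\<in>?A. if k \<le> num_ltr_max \<pi> then 1 else 0)"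
    by (simp add: finite_avoiders flip: sum.inter_filter)
  also have "\<dots> = (\<Sum>\<pi>\<in>?A. \<Sum>k = 0..N. if k \<le> num_ltr_max \<pi> then 1 else 0)"
    by (rule sum.swap)
  also have "\<dots> = (\<Sum>\<pi>\<in>?A. num_ltr_max \<pi> + 1)"
  proof (rule sum.cong[OF refl])
    fix \<pi> assume "\<pi> \<in> ?A"
    then have "{k \<in> {0..N}. k \<le> num_ltr_max \<pi>} = {0..num_ltr_max \<pi>}"
      using num_ltr_max_avoiders_le[of \<pi> \<rho> N] by auto
    then show "(\<Sum>k = 0..N. if k \<le> num_ltr_max \<pi> then 1 else 0) = num_ltr_max \<pi> + 1"
      by (simp flip: sum.inter_filter)
  qed
  finally show ?thesis using ballot_1_eq_catalan[of "Suc N"] by simp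
qed

lemma expectation_num_ltr_max:
  assumes "\<rho> \<in> {[2, 3, 1], [1, 3, 2], [2, 1, 3]}"
  shows "measure_pmf.expectation (pmf_of_set (avoiders \<rho> N)) (\<lambda>\<pi>. real (num_ltr_max \<pi>)) =
    catalan (Suc N) / catalan N - 1"
proof -
  let ?A = "avoiders \<rho> N"
  have "?A \<noteq> {}" using card_avoiders[OF assms, of N] catalan_pos[of N] by auto
  then have "measure_pmf.expectation (pmf_of_set ?A) (\<lambda>\<pi>. real (num_ltr_max \<pi>)) =
      (\<Sum>\<pi>\<in>?A. real (num_ltr_max \<pi>)) / catalan N"
    using card_avoiders[OF assms, of N] by (simp add: integral_pmf_of_set finite_avoiders)
  moreover have "(\<Sum>\<pi>\<in>?A. real (num_ltr_max \<pi>)) = catalan (Suc N) - catalan N"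
    using sum_Suc_num_ltr_max[OF assms, of N] card_avoiders[OF assms, of N]
    by (simp add: sum.distrib)
  ultimately show ?thesis using catalan_pos[of N] by (simp add: diff_divide_distrib)
qed

section \<open>The game\<close>

lemma length_flatten [simp]: "length (flatten xs) = length xs"
  by (simp add: flatten_def)

lemma flatten_map_strict_mono:
  assumes "strict_mono_on (set xs) f"
  shows "flatten (map f xs) = flatten xs"
proof -
  have inj: "inj_on f (set xs)" using assms by (rule strict_mono_on_imp_inj_on)
  have "card {y \<in> f ` set xs. y \<le> f x} = card {y \<in> set xs. y \<le> x}" if "x \<in> set xs" for x
  proof -
    have "{y \<in> f ` set xs. y \<le> f x} = f ` {y \<in> set xs. y \<le> x}"
      using that strict_mono_on_less_eq[OF assms] by auto
    then show ?thesis
      using card_image[OF inj_on_subset[OF inj, of "{y \<in> set xs. y \<le> x}"]] by auto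
  qed
  then show ?thesis by (simp add: flatten_def)
qed

lemma strict_mono_on_rank: "strict_mono_on S (\<lambda>x. card {y \<in> S. y \<le> x})" if "finite S"
  for S :: "nat set"
proof (rule strict_mono_onI)
  fix r s assume "r \<in> S" "s \<in> S" "r < s"
  then have "s \<in> {y \<in> S. y \<le> s} - {y \<in> S. y \<le> r}" "{y \<in> S. y \<le> r} \<subseteq> {y \<in> S. y \<le> s}"
    by auto
  then have "{y \<in> S. y \<le> r} \<subset> {y \<in> S. y \<le> s}" by blast
  with that show "card {y \<in> S. y \<le> r} < card {y \<in> S. y \<le> s}"
    by (intro psubset_card_mono) auto
qed

text \<open>Replacing entries by ranks is strictly monotone, so a later flattening does not notice
  it.\<close>

lemma flat_prefix_flatten: "flat_prefix j (flatten xs) = flat_prefix j xs"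
proof -
  have "strict_mono_on (set (take j xs)) (\<lambda>x. card {y \<in> set xs. y \<le> x})"
    by (rule monotone_on_subset[OF strict_mono_on_rank set_take_subset]) simp
  then show ?thesis
    by (simp add: flat_prefix_def flatten_def[of xs] take_map flatten_map_strict_mono)
qed

lemma flat_prefix_flat_prefix: "j \<le> i \<Longrightarrow> flat_prefix j (flat_prefix i xs) = flat_prefix j xs"
  using flat_prefix_flatten[of j "take i xs"] by (simp add: flat_prefix_def min_absorb1)

lemma length_flat_prefix: "i \<le> length xs \<Longrightarrow> length (flat_prefix i xs) = i"
  by (simp add: flat_prefix_def)

lemma flatten_perms: "xs \<in> perms n \<Longrightarrow> flatten xs = xs"
proof -
  assume xs: "xs \<in> perms n"
  have "card {y \<in> {1..n}. y \<le> x} = x" if "x \<in> {1..n}" for x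
  proof -
    have "{y \<in> {1..n}. y \<le> x} = {1..x}" using that by auto
    then show ?thesis by simp
  qed
  then show ?thesis using xs by (auto simp: flatten_def perms_iff intro: map_idI)
qed

lemma flat_prefix_perms: "xs \<in> perms n \<Longrightarrow> flat_prefix n xs = xs"
  by (simp add: flat_prefix_def perms_length flatten_perms)

lemma ltr_max_position_flat_prefix:
  assumes "i \<in> ltr_max_positions (flat_prefix i xs)" "i \<le> length xs"
  shows "i \<in> ltr_max_positions xs"
proof -
  have i: "1 \<le> i" using assms(1) by (auto simp: ltr_max_positions_def)
  have "xs ! (j - 1) < xs ! (i - 1)" if "j \<in> {1..<i}" for j
  proof (rule ccontr)
    assume "\<not> xs ! (j - 1) < xs ! (i - 1)"
    then have "card {y \<in> set (take i xs). y \<le> xs ! (i - 1)} \<le> card {y \<in> set (take i xs). y \<le> xs ! (j - 1)}"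
      by (intro card_mono) auto
    moreover have "flat_prefix i xs ! (j - 1) < flat_prefix i xs ! (i - 1)"
      using assms(1) that by (auto simp: ltr_max_positions_def)
    moreover have "j - 1 < i" "j - 1 < length xs" using that assms(2) by auto
    ultimately show False
      using i assms(2) by (simp add: flat_prefix_def flatten_def)
  qed
  with i assms(2) show ?thesis by (simp add: ltr_max_positions_def)
qed

section \<open>Maximal antichains and winning\<close>

text \<open>Maximality gives an element comparable to \<pi>, which must be a prefix since \<pi> has
  full length. Two prefixes of one permutation are comparable, so an antichain contains only
  one.\<close>

lemma maximal_antichain_ex1_flat_prefix:
  assumes A: "maximal_antichain n A" and \<pi>: "\<pi> \<in> prefix_tree n" "length \<pi> = n"
  shows "\<exists>!i. i \<in> ltr_max_positions \<pi> \<and> flat_prefix i \<pi> \<in> A"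
proof -
  have perm: "\<pi> \<in> perms n"
    using \<pi> perms_length by (auto simp: prefix_tree_def)
  have ltr: "i \<in> ltr_max_positions \<pi>" if "flat_prefix i \<pi> \<in> A" "i \<le> n" for i
  proof -
    from A that have "flat_prefix i \<pi> \<in> prefix_tree n" by (auto simp: maximal_antichain_def)
    then obtain m where m: "flat_prefix i \<pi> \<in> perms m" "m \<in> ltr_max_positions (flat_prefix i \<pi>)"
      by (auto simp: prefix_tree_def)
    then have "m = i" using perms_length[OF m(1)] length_flat_prefix[of i \<pi>] that \<pi> by simp
    then show ?thesis using ltr_max_position_flat_prefix[of i \<pi>] m that \<pi> by simp
  qed
  obtain q where q: "q \<in> A" "comparable \<pi> q"
    using A \<pi>(1) by (auto simp: maximal_antichain_def)
  then obtain m where m: "q \<in> perms m" "m \<le> n"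
    using A by (auto simp: maximal_antichain_def prefix_tree_def)
  have "flat_prefix m \<pi> = q"
  proof (cases "contains_prefix \<pi> q")
    case True
    then show ?thesis using perms_length[OF m(1)] by (simp add: contains_prefix_def)
  next
    case False
    then have "contains_prefix q \<pi>" using q by (simp add: comparable_def)
    \<comment> \<open>No tree element is longer than \<pi>, so containing \<pi> means being
      \<pi>.\<close>
    then have "n \<le> m" "flat_prefix n q = \<pi>"
      using perms_length[OF m(1)] \<pi> by (auto simp: contains_prefix_def)
    with m have "m = n" "q = \<pi>" using flat_prefix_perms[of q m] by auto
    then show ?thesis using flat_prefix_perms[OF perm] by simp
  qed
  then have ex: "m \<in> ltr_max_positions \<pi> \<and> flat_prefix m \<pi> \<in> A"
    using ltr[of m] q m by simp
  have no: False if "i < j" "j \<le> n" "flat_prefix i \<pi> \<in> A" "flat_prefix j \<pi> \<in> A" for i j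
  proof -
    have len: "length (flat_prefix i \<pi>) = i" "length (flat_prefix j \<pi>) = j"
      using that \<pi> by (simp_all add: length_flat_prefix)
    then have "contains_prefix (flat_prefix j \<pi>) (flat_prefix i \<pi>)"
      using that flat_prefix_flat_prefix[of i j \<pi>] by (simp add: contains_prefix_def)
    moreover have "flat_prefix i \<pi> \<noteq> flat_prefix j \<pi>" using len that by auto
    ultimately show False
      using A that unfolding maximal_antichain_def comparable_def by blast
  qed
  show ?thesis
  proof (rule ex1I[of _ m])
    show "m \<in> ltr_max_positions \<pi> \<and> flat_prefix m \<pi> \<in> A" by (rule ex)
  next
    fix i assume i: "i \<in> ltr_max_positions \<pi> \<and> flat_prefix i \<pi> \<in> A"
    then have "i \<le> n" using \<pi> by (auto simp: ltr_max_positions_def)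
    with i ex m(2) show "i = m" using no[of i m] no[of m i] by (metis linorder_neqE_nat)
  qed
qed

text \<open>The value \<open>n\<close> stands only at position \<open>i\<close> of \<tau>, so
  winning means stopping there. Up to \<open>i\<close> the flattened prefixes are those of \<pi>,
  and an earlier strike would be comparable to the prefix at \<open>i\<close>.\<close>

lemma wins_iff:
  assumes A: "maximal_antichain n A" and \<pi>: "\<pi> \<in> prefix_tree n" "length \<pi> = n"
    and i: "i \<in> ltr_max_positions \<pi>"
    and \<tau>: "\<tau> \<in> perms n" "flat_prefix i \<tau> = flat_prefix i \<pi>" "\<tau> ! (i - 1) = n"
  shows "wins n A \<tau> \<longleftrightarrow> flat_prefix i \<pi> \<in> A"
proof -
  have range: "1 \<le> i" "i \<le> n" using i \<pi> by (auto simp: ltr_max_positions_def)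
  have eq: "j = i" if "j \<in> {1..n}" "\<tau> ! (j - 1) = n" for j
  proof -
    have "j - 1 = i - 1"
      using that \<tau> range perms_length[OF \<tau>(1)] nth_eq_iff_index_eq[of \<tau> "j - 1" "i - 1"]
      by (auto simp: perms_iff)
    with that range show ?thesis by auto
  qed
  have pre: "flat_prefix j \<tau> = flat_prefix j \<pi>" if "j \<le> i" for j
    using flat_prefix_flat_prefix[OF that, of \<tau>] flat_prefix_flat_prefix[OF that, of \<pi>] \<tau>(2) by simp
  show ?thesis
  proof
    assume "wins n A \<tau>"
    then show "flat_prefix i \<pi> \<in> A" using eq \<tau>(2) by (auto simp: wins_def)
  next
    assume in_A: "flat_prefix i \<pi> \<in> A"
    have "flat_prefix j \<tau> \<notin> A" if "j \<in> {1..<i}" for j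
    proof
      assume "flat_prefix j \<tau> \<in> A"
      then have j: "flat_prefix j \<pi> \<in> A" using pre[of j] that by simp
      have len: "length (flat_prefix i \<pi>) = i" "length (flat_prefix j \<pi>) = j"
        using that range \<pi> by (simp_all add: length_flat_prefix)
      then have "contains_prefix (flat_prefix i \<pi>) (flat_prefix j \<pi>)"
        using that flat_prefix_flat_prefix[of j i \<pi>] by (simp add: contains_prefix_def)
      moreover have "flat_prefix i \<pi> \<noteq> flat_prefix j \<pi>" using len that by auto
      ultimately show False
        using A j in_A unfolding maximal_antichain_def comparable_def by blast
    qed
    then show "wins n A \<tau>"
      unfolding wins_def using range in_A \<tau> by (intro bexI[of _ i]) auto
  qed
qed

lemma snoc_max_mem_prefix_tree:
  assumes "\<sigma> \<in> perms (n - 1)" "n \<ge> 1"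
  shows "\<sigma> @ [n] \<in> prefix_tree n" "length (\<sigma> @ [n]) = n" "\<sigma> @ [n] \<in> perms n"
    "num_ltr_max (\<sigma> @ [n]) = num_ltr_max \<sigma> + 1"
proof -
  have lt: "\<forall>y\<in>set \<sigma>. y < n" using assms by (auto simp: perms_iff)
  have "{1..n} = insert n {1..n - 1}" using assms(2) by auto
  then show p: "\<sigma> @ [n] \<in> perms n" using assms(1) lt by (auto simp: perms_iff)
  show len: "length (\<sigma> @ [n]) = n" using p by (rule perms_length)
  have "n \<in> ltr_max_positions (\<sigma> @ [n])"
    using lt len by (simp add: ltr_max_positions_snoc)
  then show "\<sigma> @ [n] \<in> prefix_tree n"
    using p assms(2) by (auto simp: prefix_tree_def)
  show "num_ltr_max (\<sigma> @ [n]) = num_ltr_max \<sigma> + 1"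
    using lt by (simp add: num_ltr_max_snoc)
qed

lemma size_competitor_positions:
  assumes "n \<ge> 1" "set_mset J' \<subseteq> perms (n - 1)"
  shows "size (competitor_positions n J') = (\<Sum>\<sigma>\<in>#J'. num_ltr_max \<sigma> + 1)"
  using assms(2)
proof (induction J')
  case empty
  then show ?case by (simp add: competitor_positions_def)
next
  case (add \<sigma> J')
  then show ?case
    using snoc_max_mem_prefix_tree(4)[of \<sigma> n] assms(1)
    by (simp add: competitor_positions_def num_ltr_max_def)
qed

lemma size_filter_competitor_positions:
  assumes "n \<ge> 1" "set_mset J' \<subseteq> perms (n - 1)" "maximal_antichain n A"
  shows "size (filter_mset (\<lambda>(\<pi>, i). flat_prefix i \<pi> \<in> A) (competitor_positions n J')) = size J'"
  using assms(2)
proof (induction J')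
  case empty
  then show ?case by (simp add: competitor_positions_def)
next
  case (add \<sigma> J')
  let ?\<pi> = "\<sigma> @ [n]"
  have "\<sigma> \<in> perms (n - 1)" using add.prems by simp
  then obtain m where "\<And>i. i \<in> ltr_max_positions ?\<pi> \<and> flat_prefix i ?\<pi> \<in> A \<longleftrightarrow> i = m"
    using maximal_antichain_ex1_flat_prefix[OF assms(3)] snoc_max_mem_prefix_tree[OF _ assms(1)]
    by metis
  then have "{i \<in> ltr_max_positions ?\<pi>. flat_prefix i ?\<pi> \<in> A} = {m}" by blast
  then have "size (filter_mset (\<lambda>(\<pi>, i). flat_prefix i \<pi> \<in> A)
      (image_mset (Pair ?\<pi>) (mset_set (ltr_max_positions ?\<pi>)))) = 1"
    by (simp add: filter_mset_image_mset filter_mset_mset_set)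
  with add show ?case by (simp add: competitor_positions_def)
qed

lemma prob_pmf_of_multiset:
  assumes "I \<noteq> {#}"
  shows "measure_pmf.prob (pmf_of_multiset I) {x. P x} = size (filter_mset P I) / size I"
proof -
  have "measure_pmf.prob (pmf_of_multiset I) {x. P x} =
      measure_pmf.prob (pmf_of_multiset I) ({x. P x} \<inter> set_pmf (pmf_of_multiset I))"
    by (rule measure_Int_set_pmf[symmetric])
  also have "\<dots> = (\<Sum>x\<in>{x \<in> set_mset I. P x}. count I x / size I)"
    using assms by (subst measure_measure_pmf_finite) (auto intro!: sum.cong)
  also have "\<dots> = (\<Sum>x\<in>set_mset (filter_mset P I). real (count (filter_mset P I) x)) / size I"
    by (simp add: sum_divide_distrib)
  finally show ?thesis by (simp add: size_multiset_overloaded_eq)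
qed

lemma strike_win_prob_bine_game:
  assumes game: "bine_game n J' I" and A: "maximal_antichain n A"
  shows "strike_win_prob n I A = size J' / real (\<Sum>\<sigma>\<in>#J'. num_ltr_max \<sigma> + 1)"
proof -
  let ?R = "\<lambda>(\<pi>, i) \<tau>. \<tau> \<in> perms n \<and> flat_prefix i \<tau> = flat_prefix i \<pi> \<and> \<tau> ! (i - 1) = n"
  let ?C = "competitor_positions n J'"
  have n: "n \<ge> 1" and J': "J' \<noteq> {#}" "set_mset J' \<subseteq> perms (n - 1)" and rel: "rel_mset ?R ?C I"
    using game by (auto simp: bine_game_def)
  \<comment> \<open>\<open>Z\<close> is the multiset of matched pairs; along it the winning
    condition on \<tau> is carried over to the pair of competitor and position.\<close>
  from rel obtain Z where Z: "set_mset Z \<subseteq> {(p, \<tau>). ?R p \<tau>}"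
    "image_mset fst Z = ?C" "image_mset snd Z = I"
    unfolding multiset.in_rel by blast
  have iff: "wins n A (snd z) \<longleftrightarrow> (case fst z of (\<pi>, i) \<Rightarrow> flat_prefix i \<pi> \<in> A)" if "z \<in># Z" for z
  proof -
    obtain \<pi> i \<tau> where z: "z = ((\<pi>, i), \<tau>)" by (metis prod.exhaust)
    have "(\<pi>, i) \<in># ?C" using that unfolding z Z(2)[symmetric] by force
    then obtain \<sigma> where \<sigma>: "\<sigma> \<in># J'" "\<pi> = \<sigma> @ [n]" "i \<in> ltr_max_positions \<pi>"
      by (auto simp: competitor_positions_def)
    moreover have "\<sigma> \<in> perms (n - 1)" using \<sigma> J' by auto
    moreover have "?R (\<pi>, i) \<tau>" using Z(1) that z by auto
    ultimately show ?thesis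
      using wins_iff[OF A, of \<pi> i \<tau>] snoc_max_mem_prefix_tree[OF _ n] z by simp
  qed
  have "filter_mset (wins n A) I = image_mset snd (filter_mset (\<lambda>z. wins n A (snd z)) Z)"
    by (simp add: filter_mset_image_mset flip: Z(3))
  also have "filter_mset (\<lambda>z. wins n A (snd z)) Z =
      filter_mset (\<lambda>z. case fst z of (\<pi>, i) \<Rightarrow> flat_prefix i \<pi> \<in> A) Z"
    by (rule filter_mset_cong[OF refl]) (rule iff)
  finally have "size (filter_mset (wins n A) I) =
      size (filter_mset (\<lambda>(\<pi>, i). flat_prefix i \<pi> \<in> A) ?C)"
    by (simp add: filter_mset_image_mset flip: Z(2))
  then have "size (filter_mset (wins n A) I) = size J'"
    using size_filter_competitor_positions[OF n J'(2) A] by simp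
  moreover have size: "size I = (\<Sum>\<sigma>\<in>#J'. num_ltr_max \<sigma> + 1)"
    using size_competitor_positions[OF n J'(2)] Z by (metis size_image_mset)
  moreover have "I \<noteq> {#}"
    using size J'(1) by (auto simp: sum_mset_0_iff)
  ultimately show ?thesis
    by (simp add: strike_win_prob_def prob_pmf_of_multiset)
qed

lemma strategy_indifferent_bine_game: "bine_game n J' I \<Longrightarrow> strategy_indifferent n I"
  by (simp add: strategy_indifferent_def strike_win_prob_bine_game)

text \<open>Stopping at the first entry is a strategy of this kind. Since a maximal antichain
  exists, the description in \<open>win_probability\<close> has only one solution.\<close>

lemma maximal_antichain_singleton:
  assumes "n \<ge> 1"
  shows "maximal_antichain n {[1]}"
proof -
  have one: "[1] \<in> prefix_tree n"
    using assms by (auto simp: prefix_tree_def perms_iff ltr_max_positions_def intro!: bexI[of _ 1])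
  have "contains_prefix p [1]" if p: "p \<in> prefix_tree n" for p
  proof -
    obtain i where "i \<ge> 1" "p \<in> perms i" using p by (auto simp: prefix_tree_def)
    then have "p \<noteq> []" using perms_length by fastforce
    then obtain x xs where "p = x # xs" by (cases p) auto
    moreover have "{y. y = x \<and> y \<le> x} = {x}" by auto
    ultimately show ?thesis by (simp add: contains_prefix_def flat_prefix_def flatten_def)
  qed
  with one show ?thesis by (auto simp: maximal_antichain_def comparable_def)
qed

lemma win_probability_bine_game:
  assumes "bine_game n J' I"
  shows "win_probability n I = size J' / real (\<Sum>\<sigma>\<in>#J'. num_ltr_max \<sigma> + 1)"
  unfolding win_probability_def
proof (rule the_equality)
  show "\<forall>A. maximal_antichain n A \<longrightarrow>
      strike_win_prob n I A = size J' / real (\<Sum>\<sigma>\<in>#J'. num_ltr_max \<sigma> + 1)"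
    using strike_win_prob_bine_game[OF assms] by blast
next
  fix p assume "\<forall>A. maximal_antichain n A \<longrightarrow> strike_win_prob n I A = p"
  moreover have "maximal_antichain n {[1]}"
    using assms by (intro maximal_antichain_singleton) (simp add: bine_game_def)
  ultimately show "p = size J' / real (\<Sum>\<sigma>\<in>#J'. num_ltr_max \<sigma> + 1)"
    using strike_win_prob_bine_game[OF assms] by metis
qed

section \<open>Existence of bine games and the final theorem\<close>

text \<open>Swapping the entry \<open>v\<close> at position \<open>i\<close> with \<open>n\<close>
  works: \<open>v\<close> is the largest among the first \<open>i\<close> entries, and raising the
  largest keeps their relative order.\<close>

lemma ex_perm_max_at_ltr_max_position:
  assumes \<pi>: "\<pi> \<in> perms n" and i: "i \<in> ltr_max_positions \<pi>"
  shows "\<exists>\<tau>\<in>perms n. flat_prefix i \<tau> = flat_prefix i \<pi> \<and> \<tau> ! (i - 1) = n"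
proof -
  define v where "v = \<pi> ! (i - 1)"
  define f where "f = Transposition.transpose v n"
  have range: "1 \<le> i" "i \<le> n" and max: "\<And>j. j \<in> {1..<i} \<Longrightarrow> \<pi> ! (j - 1) < v"
    using i perms_length[OF \<pi>] by (auto simp: ltr_max_positions_def v_def)
  have len: "length \<pi> = n" using \<pi> by (rule perms_length)
  have v: "v \<in> {1..n}" using \<pi> range len nth_mem[of "i - 1" \<pi>] by (simp add: perms_iff v_def)
  have "f permutes {1..n}"
    unfolding f_def using v by (intro permutes_swap_id) auto
  then have perm: "map f \<pi> \<in> perms n"
    using \<pi> by (auto simp: perms_iff distinct_map permutes_image permutes_inj_on)
  have le: "x \<le> v" if x: "x \<in> set (take i \<pi>)" for x
  proof -
    obtain k where k: "k < i" "x = \<pi> ! k"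
      using x range len by (auto simp: in_set_conv_nth)
    show ?thesis
    proof (cases "k = i - 1")
      case False
      then have "Suc k < i" using k(1) by simp
      then show ?thesis using max[of "Suc k"] k(2) by simp
    qed (simp add: k v_def)
  qed
  have "strict_mono_on (set (take i \<pi>)) f"
  proof (rule strict_mono_onI)
    fix x y assume "x \<in> set (take i \<pi>)" "y \<in> set (take i \<pi>)" "x < y"
    then have "x < v" "y \<le> v" "v \<le> n" using le[of y] v by auto
    with \<open>x < y\<close> show "f x < f y"
      by (cases "y = v") (simp_all add: f_def transpose_def)
  qed
  then have "flat_prefix i (map f \<pi>) = flat_prefix i \<pi>"
    by (simp add: flat_prefix_def take_map flatten_map_strict_mono)
  moreover have "map f \<pi> ! (i - 1) = n"
    using range len by (simp add: f_def v_def)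
  ultimately show ?thesis using perm by blast
qed

text \<open>Ensures that statements about all bine games, the limit among them, are not
  vacuous.\<close>

lemma bine_game_exists:
  assumes "n \<ge> 1" "J' \<noteq> {#}" "set_mset J' \<subseteq> perms (n - 1)"
  shows "\<exists>I. bine_game n J' I"
proof -
  let ?R = "\<lambda>(\<pi>, i) \<tau>. \<tau> \<in> perms n \<and> flat_prefix i \<tau> = flat_prefix i \<pi> \<and> \<tau> ! (i - 1) = n"
  have "\<exists>\<tau>. ?R p \<tau>" if mem: "p \<in># competitor_positions n J'" for p
  proof -
    obtain \<sigma> i where p: "\<sigma> \<in># J'" "p = (\<sigma> @ [n], i)" "i \<in> ltr_max_positions (\<sigma> @ [n])"
      using mem by (auto simp: competitor_positions_def)
    then have "\<sigma> @ [n] \<in> perms n" using assms snoc_max_mem_prefix_tree(3)[of \<sigma> n] by auto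
    from ex_perm_max_at_ltr_max_position[OF this p(3)] show ?thesis unfolding p by auto
  qed
  then have f: "?R p (SOME \<tau>. ?R p \<tau>)" if "p \<in># competitor_positions n J'" for p
    by (rule someI_ex[OF _]) (rule that)
  define f where "f = (\<lambda>p. SOME \<tau>. ?R p \<tau>)"
  have "rel_mset ?R (competitor_positions n J') (image_mset f (competitor_positions n J'))"
    unfolding multiset.rel_map(2) f_def by (rule multiset.rel_refl_strong) (rule f)
  then show ?thesis using assms unfolding bine_game_def by blast
qed

theorem mainTheorem10:
  fixes \<rho> :: "nat list"
  assumes "\<rho> \<in> {[2, 3, 1], [1, 3, 2], [2, 1, 3]}"
  shows
    "(\<forall>N\<ge>1. \<forall>k\<in>{1..N}.
        real (card {\<pi> \<in> avoiders \<rho> N. num_ltr_max \<pi> = k}) =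
          real k / real (2 * N - k) * real ((2 * N - k) choose N)) \<and>
     (\<forall>N\<ge>1.
        measure_pmf.expectation (pmf_of_set (avoiders \<rho> N)) (\<lambda>\<pi>. real (num_ltr_max \<pi>)) =
          catalan (N + 1) / catalan N - 1 \<and>
        catalan (N + 1) / catalan N - 1 = 3 * real N / (real N + 2)) \<and>
     (\<forall>N\<ge>1. (\<exists>I. bine_game (N + 1) (mset_set (avoiders \<rho> N)) I) \<and>
        (\<forall>I. bine_game (N + 1) (mset_set (avoiders \<rho> N)) I \<longrightarrow> strategy_indifferent (N + 1) I)) \<and>
     (\<forall>I. (\<forall>N\<ge>1. bine_game (N + 1) (mset_set (avoiders \<rho> N)) (I N)) \<longrightarrow>
        (\<lambda>N. win_probability (N + 1) (I N)) \<longlonglongrightarrow> 1 / 4)"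
proof (intro conjI allI ballI impI)
  fix N k :: nat
  assume "k \<in> {1..N}"
  then show "real (card {\<pi> \<in> avoiders \<rho> N. num_ltr_max \<pi> = k}) =
      real k / real (2 * N - k) * real ((2 * N - k) choose N)"
    unfolding card_avoiders_num_ltr_max[OF assms] by (rule ballot_closed_form)
next
  fix N :: nat
  show "measure_pmf.expectation (pmf_of_set (avoiders \<rho> N)) (\<lambda>\<pi>. real (num_ltr_max \<pi>)) =
      catalan (N + 1) / catalan N - 1"
    using expectation_num_ltr_max[OF assms] by simp
  show "catalan (N + 1) / catalan N - 1 = 3 * real N / (real N + 2)"
    using catalan_Suc_ratio[of N] by (simp add: field_simps)
next
  fix N :: nat
  have "avoiders \<rho> N \<noteq> {}"
    using card_avoiders[OF assms, of N] catalan_pos[of N] by auto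
  then show "\<exists>I. bine_game (N + 1) (mset_set (avoiders \<rho> N)) I"
    using finite_avoiders[of \<rho> N]
    by (intro bine_game_exists) (auto simp: mset_set_empty_iff, auto simp: avoiders_def)
next
  fix N :: nat and I
  assume "bine_game (N + 1) (mset_set (avoiders \<rho> N)) I"
  then show "strategy_indifferent (N + 1) I"
    by (rule strategy_indifferent_bine_game)
next
  fix I
  assume game: "\<forall>N\<ge>1. bine_game (N + 1) (mset_set (avoiders \<rho> N)) (I N)"
  have "win_probability (N + 1) (I N) = (real N + 2) / (4 * real N + 2)" if "N \<ge> 1" for N
  proof -
    have "win_probability (N + 1) (I N) = catalan N / catalan (Suc N)"
      using win_probability_bine_game[of "N + 1" "mset_set (avoiders \<rho> N)" "I N"] game that
        sum_Suc_num_ltr_max[OF assms, of N] card_avoiders[OF assms, of N]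
      by (simp add: sum_unfold_sum_mset)
    also have "\<dots> = inverse (catalan (Suc N) / catalan N)" by simp
    finally show ?thesis by (simp add: catalan_Suc_ratio)
  qed
  \<comment> \<open>The formula is known only from N = 1 on, as \<open>I 0\<close> is arbitrary;
    eventual equality suffices for the limit.\<close>
  then have "eventually (\<lambda>N. (real N + 2) / (4 * real N + 2) = win_probability (N + 1) (I N)) sequentially"
    by (intro eventually_sequentiallyI[of 1]) simp
  moreover have "(\<lambda>N. (real N + 2) / (4 * real N + 2)) \<longlonglongrightarrow> 1 / 4"
    by real_asymp
  ultimately show "(\<lambda>N. win_probability (N + 1) (I N)) \<longlonglongrightarrow> 1 / 4"
    by (rule Lim_transform_eventually[rotated])
qed

end
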